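(* There exists a positive self-adjoint operator $\check H$ in $\mathcal H_{\mathrm{aux}}$ such that $$\lim_{\lambda\downarrow 0}(\check H_\lambda+1)^{-1}=(\check H+1)^{-1}\quad\text{strongly}.$$ Furthermore, defining $\check{\mathcal E}_0$ in $\mathcal H_{\mathrm{aux}}$ by $$\operatorname{dom}\check{\mathcal E}_0:=\operatorname{ran}J,\qquad \check{\mathcal E}_0[Ju]:=\lim_{\lambda\downarrow 0}\check{\mathcal E}_\lambda[Ju]\quad\text{for all }u\in\operatorname{dom}J,$$ the operator $\check H$ is the self-adjoint operator associated with the closure of the regular part $(\check{\mathcal E}_0)_{\mathrm{reg}}$. In particular, if $\check{\mathcal E}_0$ is closable, then $\check H$ is the self-adjoint operator associated with the closure of $\check{\mathcal E}_0$.
   Context: Let $\mathcal H,\mathcal H_{\mathrm{aux}}$ be Hilbert spaces. Let $\mathcal E$ be a closed positive (i.e. symmetric, nonnegative) quadratic form with domain $\mathcal D\subseteq\mathcal H$; write $\mathcal E(\cdot,\cdot)$ for the associated sesquilinear form, $\mathcal E[u]:=\mathcal E(u,u)$, and $\mathcal E_\lambda[u]:=\mathcal E[u]+\lambda\|u\|^2$ for $\lambda>0$. Let $J\colon\operatorname{dom}J\subseteq\mathcal D\to\mathcal H_{\mathrm{aux}}$ be a linear operator with dense range which is closed as an operator from $(\mathcal D,\mathcal E_1^{1/2})$ to $\mathcal H_{\mathrm{aux}}$. For $\lambda>0$ let $P_\lambda$ be the $\mathcal E_\lambda$-orthogonal projection in the Hilbert space $(\mathcal D,\mathcal E_\lambda^{1/2})$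 onto the $\mathcal E_\lambda$-orthogonal complement of $\ker J$. Define the closed positive densely defined quadratic form $\check{\mathcal E}_\lambda$ in $\mathcal H_{\mathrm{aux}}$ by $\operatorname{dom}\check{\mathcal E}_\lambda:=\operatorname{ran}J$, $\check{\mathcal E}_\lambda[Ju]:=\mathcal E_\lambda[P_\lambda u]$ for $u\in\operatorname{dom}J$, and let $\check H_\lambda$ be the positive self-adjoint operator in $\mathcal H_{\mathrm{aux}}$ associated with $\check{\mathcal E}_\lambda$. For a densely defined positive quadratic form $Q$ on a Hilbert space, the regular part $Q_{\mathrm{reg}}$ is the largest positive densely defined closable quadratic form (with the same domain as $Q$) dominated by $Q$; if $Q$ is closable, $Q_{\mathrm{reg}}=Q$. "Positive" means nonnegative throughout. *)

theory Defs
  imports "HOL-Analysis.Analysis"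
begin

text \<open>Complex Hilbert spaces. The inner product is linear in its first argument; norm and
  topology are those of the underlying real Hilbert space, with real inner product
  \<open>Re (cinner x y)\<close>.\<close>

class chilbert = real_inner + complete_space +
  fixes scaleC :: "complex \<Rightarrow> 'a \<Rightarrow> 'a"  (infixr "*\<^sub>C" 75)
    and cinner :: "'a \<Rightarrow> 'a \<Rightarrow> complex"
  assumes scaleR_scaleC: "r *\<^sub>R x = complex_of_real r *\<^sub>C x"
    and scaleC_add_right: "a *\<^sub>C (x + y) = a *\<^sub>C x + a *\<^sub>C y"
    and scaleC_add_left: "(a + b) *\<^sub>C x = a *\<^sub>C x + b *\<^sub>C x"
    and scaleC_scaleC: "a *\<^sub>C (b *\<^sub>C x) = (a * b) *\<^sub>C x"
    and cinner_commute: "cinner x y = cnj (cinner y x)"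
    and cinner_add_left: "cinner (x + y) z = cinner x z + cinner y z"
    and cinner_scaleC_left: "cinner (a *\<^sub>C x) y = a * cinner x y"
    and inner_eq_Re_cinner: "x \<bullet> y = Re (cinner x y)"

instantiation complex :: chilbert
begin

definition "scaleC a x = a * x" for a x :: complex
definition "cinner x y = x * cnj y" for x y :: complex

instance
  by standard (auto simp: scaleC_complex_def cinner_complex_def scaleR_conv_of_real
      algebra_simps inner_complex_def)

end

definition csubspace :: "'a::chilbert set \<Rightarrow> bool" where
  "csubspace S \<longleftrightarrow> 0 \<in> S \<and> (\<forall>x\<in>S. \<forall>y\<in>S. x + y \<in> S) \<and> (\<forall>a. \<forall>x\<in>S. a *\<^sub>C x \<in> S)"


subsection \<open>Unbounded operators\<close>

text \<open>Partially defined operators and forms are represented as maps (\<open>\<rightharpoonup>\<close>), so that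
  \<open>dom\<close> is the domain, \<open>ran\<close> the range of an operator, \<open>\<subseteq>\<^sub>m\<close> is extension, and two operators
  (or forms) are equal iff they have the same domain and the same values on it.\<close>

definition linear_operator :: "('a::chilbert \<rightharpoonup> 'b::chilbert) \<Rightarrow> bool" where
  "linear_operator T \<longleftrightarrow> csubspace (dom T) \<and>
     (\<forall>x\<in>dom T. \<forall>y\<in>dom T. T (x + y) = Some (the (T x) + the (T y))) \<and>
     (\<forall>a. \<forall>x\<in>dom T. T (a *\<^sub>C x) = Some (a *\<^sub>C the (T x)))"

definition op_kernel :: "('a::chilbert \<rightharpoonup> 'b::chilbert) \<Rightarrow> 'a set" where
  "op_kernel T = {x. T x = Some 0}"

definition densely_defined :: "('a::chilbert \<rightharpoonup> 'b) \<Rightarrow> bool" where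
  "densely_defined T \<longleftrightarrow> closure (dom T) = UNIV"

definition adjoint_op :: "('a::chilbert \<rightharpoonup> 'a) \<Rightarrow> ('a \<rightharpoonup> 'a)" where
  "adjoint_op T = (\<lambda>y.
     if \<exists>z. \<forall>x\<in>dom T. cinner (the (T x)) y = cinner x z
     then Some (THE z. \<forall>x\<in>dom T. cinner (the (T x)) y = cinner x z) else None)"

definition self_adjoint :: "('a::chilbert \<rightharpoonup> 'a) \<Rightarrow> bool" where
  "self_adjoint T \<longleftrightarrow> linear_operator T \<and> densely_defined T \<and> adjoint_op T = T"

definition positive_self_adjoint :: "('a::chilbert \<rightharpoonup> 'a) \<Rightarrow> bool" where
  "positive_self_adjoint T \<longleftrightarrow>
     self_adjoint T \<and> (\<forall>x\<in>dom T. 0 \<le> Re (cinner (the (T x)) x))"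

text \<open>\<open>inv_plus_one T\<close> is the operator \<open>(T + 1)\<^sup>-\<^sup>1\<close>, for \<open>T\<close> with \<open>T + 1\<close> bijective from
  \<open>dom T\<close> onto the whole space (as is the case for positive self-adjoint \<open>T\<close>).\<close>

definition inv_plus_one :: "('a::chilbert \<rightharpoonup> 'a) \<Rightarrow> 'a \<Rightarrow> 'a" where
  "inv_plus_one T f = (THE x. x \<in> dom T \<and> the (T x) + x = f)"


subsection \<open>Quadratic forms\<close>

definition sesquilinear_on :: "'a::chilbert set \<Rightarrow> ('a \<Rightarrow> 'a \<Rightarrow> complex) \<Rightarrow> bool" where
  "sesquilinear_on S s \<longleftrightarrow>
     (\<forall>x\<in>S. \<forall>y\<in>S. \<forall>z\<in>S. s (x + y) z = s x z + s y z \<and> s z (x + y) = s z x + s z y) \<and>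
     (\<forall>a. \<forall>x\<in>S. \<forall>y\<in>S. s (a *\<^sub>C x) y = a * s x y \<and> s x (a *\<^sub>C y) = cnj a * s x y)"

text \<open>Forms are real-valued on the diagonal, which makes the sesquilinear form symmetric.\<close>

definition positive_form :: "('a::chilbert \<rightharpoonup> real) \<Rightarrow> bool" where
  "positive_form Q \<longleftrightarrow> csubspace (dom Q) \<and>
     (\<exists>s. sesquilinear_on (dom Q) s \<and> (\<forall>u\<in>dom Q. s u u = complex_of_real (the (Q u)))) \<and>
     (\<forall>u\<in>dom Q. 0 \<le> the (Q u))"

text \<open>The associated sesquilinear form, recovered by polarization.\<close>

definition sesq :: "('a::chilbert \<rightharpoonup> real) \<Rightarrow> 'a \<Rightarrow> 'a \<Rightarrow> complex" where
  "sesq Q u v = (\<Sum>k<4. \<i> ^ k * complex_of_real (the (Q (u + \<i> ^ k *\<^sub>C v)))) / 4"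

lemma sesq_unique:
  assumes D: "csubspace (dom Q)" and s: "sesquilinear_on (dom Q) s"
    and Q: "\<And>u. u \<in> dom Q \<Longrightarrow> s u u = complex_of_real (the (Q u))"
    and u: "u \<in> dom Q" and v: "v \<in> dom Q"
  shows "sesq Q u v = s u v"
proof -
  have "complex_of_real (the (Q (u + a *\<^sub>C v)))
      = s u u + cnj a * s u v + a * s v u + a * cnj a * s v v" for a
  proof -
    have av: "a *\<^sub>C v \<in> dom Q" and uav: "u + a *\<^sub>C v \<in> dom Q"
      using D u v unfolding csubspace_def by blast+
    have "s (u + a *\<^sub>C v) (u + a *\<^sub>C v)
        = s u u + s u (a *\<^sub>C v) + (s (a *\<^sub>C v) u + s (a *\<^sub>C v) (a *\<^sub>C v))"
      using s u av uav unfolding sesquilinear_on_def by simp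
    also have "\<dots> = s u u + cnj a * s u v + (a * s v u + a * (cnj a * s v v))"
      using s u v av unfolding sesquilinear_on_def by simp
    finally show ?thesis using Q[OF uav] by (simp add: algebra_simps)
  qed
  then show ?thesis
    by (simp add: sesq_def eval_nat_numeral algebra_simps)
qed

definition closed_form :: "('a::chilbert \<rightharpoonup> real) \<Rightarrow> bool" where
  "closed_form Q \<longleftrightarrow> positive_form Q \<and>
     (\<forall>X u. (\<forall>n. X n \<in> dom Q) \<and> X \<longlonglongrightarrow> u \<and>
        (\<forall>e>0. \<exists>N. \<forall>m\<ge>N. \<forall>n\<ge>N. the (Q (X m - X n)) < e)
        \<longrightarrow> u \<in> dom Q \<and> (\<lambda>n. the (Q (X n - u))) \<longlonglongrightarrow> 0)"

definition closable_form :: "('a::chilbert \<rightharpoonup> real) \<Rightarrow> bool" where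
  "closable_form Q \<longleftrightarrow> positive_form Q \<and> (\<exists>C. closed_form C \<and> Q \<subseteq>\<^sub>m C)"

text \<open>\<open>C\<close> is the closure of \<open>Q\<close>, i.e. its smallest closed extension.\<close>

definition is_form_closure :: "('a::chilbert \<rightharpoonup> real) \<Rightarrow> ('a \<rightharpoonup> real) \<Rightarrow> bool" where
  "is_form_closure Q C \<longleftrightarrow> positive_form Q \<and> closed_form C \<and> Q \<subseteq>\<^sub>m C \<and>
     (\<forall>C'. closed_form C' \<and> Q \<subseteq>\<^sub>m C' \<longrightarrow> C \<subseteq>\<^sub>m C')"

definition closable_minorant :: "('a::chilbert \<rightharpoonup> real) \<Rightarrow> ('a \<rightharpoonup> real) \<Rightarrow> bool" where
  "closable_minorant Q R \<longleftrightarrow> closable_form R \<and> densely_defined R \<and> dom R = dom Q \<and>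
     (\<forall>u\<in>dom Q. the (R u) \<le> the (Q u))"

text \<open>\<open>R\<close> is the regular part of \<open>Q\<close>.\<close>

definition is_regular_part :: "('a::chilbert \<rightharpoonup> real) \<Rightarrow> ('a \<rightharpoonup> real) \<Rightarrow> bool" where
  "is_regular_part Q R \<longleftrightarrow> positive_form Q \<and> densely_defined Q \<and> closable_minorant Q R \<and>
     (\<forall>R'. closable_minorant Q R' \<longrightarrow> (\<forall>u\<in>dom Q. the (R' u) \<le> the (R u)))"

text \<open>The operator associated with a closed, densely defined positive form (first
  representation theorem).\<close>

definition form_operator :: "('a::chilbert \<rightharpoonup> real) \<Rightarrow> ('a \<rightharpoonup> 'a)" where
  "form_operator Q = (\<lambda>u.
     if u \<in> dom Q \<and> (\<exists>f. \<forall>v\<in>dom Q. sesq Q u v = cinner f v)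
     then Some (THE f. \<forall>v\<in>dom Q. sesq Q u v = cinner f v) else None)"


subsection \<open>Traces of forms\<close>

definition shifted_form :: "('a::chilbert \<rightharpoonup> real) \<Rightarrow> real \<Rightarrow> ('a \<rightharpoonup> real)" where
  "shifted_form E l = (\<lambda>u. map_option (\<lambda>e. e + l * (norm u)\<^sup>2) (E u))"

text \<open>Closedness of an operator from the form domain, normed by the square root of
  \<open>shifted_form E 1\<close>, to the auxiliary space.\<close>

definition closed_from_form ::
    "('a::chilbert \<rightharpoonup> real) \<Rightarrow> ('a \<rightharpoonup> 'b::chilbert) \<Rightarrow> bool" where
  "closed_from_form E J \<longleftrightarrow>
     (\<forall>X u w. (\<forall>n. X n \<in> dom J) \<and> u \<in> dom E \<and>
        (\<lambda>n. the (shifted_form E 1 (X n - u))) \<longlonglongrightarrow> 0 \<and> (\<lambda>n. the (J (X n))) \<longlonglongrightarrow> w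
        \<longrightarrow> J u = Some w)"

definition form_orthogonal_complement :: "('a::chilbert \<rightharpoonup> real) \<Rightarrow> 'a set \<Rightarrow> 'a set" where
  "form_orthogonal_complement Q S = {w \<in> dom Q. \<forall>z\<in>S. sesq Q w z = 0}"

definition form_projection :: "('a::chilbert \<rightharpoonup> real) \<Rightarrow> 'a set \<Rightarrow> 'a \<Rightarrow> 'a" where
  "form_projection Q M u = (THE w. w \<in> M \<and> (\<forall>z\<in>M. sesq Q (u - w) z = 0))"

definition trace_projection ::
    "('a::chilbert \<rightharpoonup> real) \<Rightarrow> ('a \<rightharpoonup> 'b::chilbert) \<Rightarrow> real \<Rightarrow> 'a \<Rightarrow> 'a" where
  "trace_projection E J l =
     form_projection (shifted_form E l)
       (form_orthogonal_complement (shifted_form E l) (op_kernel J))"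

text \<open>The value at \<open>v = J u\<close> does not depend on the choice of \<open>u\<close>.\<close>

definition trace_form ::
    "('a::chilbert \<rightharpoonup> real) \<Rightarrow> ('a \<rightharpoonup> 'b::chilbert) \<Rightarrow> real \<Rightarrow> ('b \<rightharpoonup> real)" where
  "trace_form E J l = (\<lambda>v.
     if v \<in> ran J
     then Some (THE r. \<forall>u. J u = Some v \<longrightarrow>
                  r = the (shifted_form E l (trace_projection E J l u)))
     else None)"

definition trace_form_zero ::
    "('a::chilbert \<rightharpoonup> real) \<Rightarrow> ('a \<rightharpoonup> 'b::chilbert) \<Rightarrow> ('b \<rightharpoonup> real)" where
  "trace_form_zero E J = (\<lambda>v.
     if v \<in> ran J then Some (Lim (at_right 0) (\<lambda>l. the (trace_form E J l v))) else None)"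

end

theory Submission
  imports Defs
begin

text \<open>
  The trace form at \<open>v\<close> is the least energy in the fibre over \<open>v\<close>: \<open>q\<^sub>\<lambda>[v] = min {E\<^sub>\<lambda>[u] | J u = v}\<close>.
  For \<open>\<lambda> > 0\<close> it is closed, because \<open>E\<close> and \<open>J\<close> are. It decreases as \<open>\<lambda> \<down> 0\<close> and has a pointwise
  limit \<open>q\<close> on \<open>ran J\<close>, which is a positive form but need not be closable
  (\<open>closed_form_trace_form\<close>, \<open>trace_form_zero_limit\<close>).

  The limit operator is read off from the lower semicontinuous relaxation
  \<open>C[u] = liminf q[w]\<close> as \<open>w \<rightarrow> u\<close>. The parallelogram law survives relaxation, so \<open>C\<close> is a quadratic
  form, and lower semicontinuity makes it closed (\<open>closed_form_relaxation\<close>). Conversely, closed forms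
  are lower semicontinuous (\<open>closed_form_lsc\<close>), so every closable minorant of \<open>q\<close> lies below \<open>C\<close>:
  the restriction of \<open>C\<close> to \<open>dom q\<close> is the regular part of \<open>q\<close>. Along a sequence \<open>w\<^sub>n \<rightarrow> u\<close> with
  \<open>q[w\<^sub>n] \<rightarrow> C[u]\<close>, the parallelogram law gives \<open>C[w\<^sub>n - u] \<rightarrow> 0\<close>, so \<open>C\<close> is the closure of its
  restriction (\<open>relaxation_regular_part\<close>).

  Finally, \<open>(H + 1)\<^sup>-\<^sup>1 f\<close>, for the operator \<open>H\<close> of a closed form \<open>Q\<close>, is the minimizer of
  \<open>Q[w] + \<parallel>w - f\<parallel>\<^sup>2\<close> (\<open>inv_plus_one_form_operator\<close>). The minimal values for \<open>q\<^sub>\<lambda>\<close> decrease to the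
  minimal value for \<open>C\<close>, since relaxing a functional does not change its infimum; uniform
  convexity then forces the minimizers to converge
  (\<open>minimizer_tendsto_relaxation\<close>). The same uniform convexity, in the form of the parallelogram
  law, yields the existence of all minimizers in \<open>nested_minimization\<close>.
\<close>

section \<open>Complex Hilbert spaces and subspaces\<close>

lemma cinner_add_right: "cinner x (y + z) = cinner x y + cinner x z"
  by (metis cinner_add_left cinner_commute complex_cnj_add)

lemma cinner_scaleC_right: "cinner x (a *\<^sub>C y) = cnj a * cinner x y"
  by (metis cinner_commute cinner_scaleC_left complex_cnj_mult)

lemma cinner_self: "cinner x x = complex_of_real ((norm x)\<^sup>2)"
proof -
  have "Im (cinner x x) = 0"
    using cinner_commute[of x x] by (metis Reals_cnj_iff complex_is_Real_iff)
  moreover have "Re (cinner x x) = (norm x)\<^sup>2"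
    by (simp add: inner_eq_Re_cinner[symmetric] power2_norm_eq_inner)
  ultimately show ?thesis by (simp add: complex_eq_iff)
qed

lemma scaleC_minus_one: "(- 1) *\<^sub>C x = - (x::'a::chilbert)"
  using scaleR_scaleC[of "- 1" x] by simp

lemma cinner_minus_left: "cinner (- x) y = - cinner x y"
  using cinner_scaleC_left[of "- 1" x y] by (simp add: scaleC_minus_one)

lemma cinner_diff_left: "cinner (x - y) z = cinner x z - cinner y z"
  using cinner_add_left[of x "- y" z] by (simp add: cinner_minus_left)

lemma cinner_diff_right: "cinner z (x - y) = cinner z x - cinner z y"
  by (metis cinner_commute cinner_diff_left complex_cnj_diff)

lemma norm_scaleC: "norm (a *\<^sub>C x) = cmod a * norm (x::'a::chilbert)"
proof -
  have "complex_of_real ((norm (a *\<^sub>C x))\<^sup>2) = a * cnj a * complex_of_real ((norm x)\<^sup>2)"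
    by (metis cinner_self cinner_scaleC_left cinner_scaleC_right mult.assoc)
  also have "\<dots> = complex_of_real ((cmod a * norm x)\<^sup>2)"
    by (simp only: of_real_mult complex_norm_square power_mult_distrib)
  finally have "(norm (a *\<^sub>C x))\<^sup>2 = (cmod a * norm x)\<^sup>2"
    by (simp only: of_real_eq_iff)
  then show ?thesis by (simp add: power2_eq_iff_nonneg)
qed

lemma scaleC_zero_right [simp]: "a *\<^sub>C (0::'a::chilbert) = 0"
  using norm_scaleC[of a "0::'a"] by simp

lemma scaleC_minus_right: "a *\<^sub>C (- x) = - (a *\<^sub>C (x::'a::chilbert))"
  by (metis mult.commute scaleC_minus_one scaleC_scaleC)

lemma scaleC_diff_right: "a *\<^sub>C (x - y) = a *\<^sub>C x - a *\<^sub>C (y::'a::chilbert)"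
  using scaleC_add_right[of a x "- y"] by (simp add: scaleC_minus_right)

lemma tendsto_scaleC:
  fixes X :: "nat \<Rightarrow> 'a::chilbert"
  assumes "X \<longlonglongrightarrow> x"
  shows "(\<lambda>n. a *\<^sub>C X n) \<longlonglongrightarrow> a *\<^sub>C x"
proof -
  have "(\<lambda>n. norm (X n - x)) \<longlonglongrightarrow> 0"
    using assms by (simp add: tendsto_norm_zero LIM_zero)
  from tendsto_mult_right_zero[OF this, of "cmod a"]
  have "(\<lambda>n. norm (a *\<^sub>C X n - a *\<^sub>C x)) \<longlonglongrightarrow> 0"
    by (simp add: norm_scaleC flip: scaleC_diff_right)
  then show ?thesis by (simp add: tendsto_norm_zero_iff LIM_zero_iff)
qed

text \<open>This makes the operator associated with a densely defined form single-valued.\<close>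

lemma cinner_dense_eq:
  fixes f g :: "'a::chilbert"
  assumes D: "closure D = UNIV" and eq: "\<And>v. v \<in> D \<Longrightarrow> cinner f v = cinner g v"
  shows "f = g"
proof -
  obtain X where X: "\<And>n. X n \<in> D" and lim: "X \<longlonglongrightarrow> f - g"
    using D closure_sequential[of "f - g" D] by auto
  have "(f - g) \<bullet> X n = 0" for n
    using eq[OF X] by (simp add: inner_eq_Re_cinner cinner_diff_left)
  moreover have "(\<lambda>n. (f - g) \<bullet> X n) \<longlonglongrightarrow> (f - g) \<bullet> (f - g)"
    using lim by (intro tendsto_intros)
  ultimately show ?thesis by (simp add: LIMSEQ_const_iff)
qed

lemma csubspace_zero: "csubspace S \<Longrightarrow> 0 \<in> S"
  and csubspace_add: "csubspace S \<Longrightarrow> x \<in> S \<Longrightarrow> y \<in> S \<Longrightarrow> x + y \<in> S"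
  and csubspace_scaleC: "csubspace S \<Longrightarrow> x \<in> S \<Longrightarrow> a *\<^sub>C x \<in> S"
  by (auto simp: csubspace_def)

lemma csubspace_minus: "csubspace S \<Longrightarrow> x \<in> S \<Longrightarrow> - x \<in> S"
  by (metis csubspace_scaleC scaleC_minus_one)

lemma csubspace_diff: "csubspace S \<Longrightarrow> x \<in> S \<Longrightarrow> y \<in> S \<Longrightarrow> x - y \<in> S"
  using csubspace_add csubspace_minus by fastforce

lemma csubspace_scaleR: "csubspace S \<Longrightarrow> x \<in> S \<Longrightarrow> r *\<^sub>R x \<in> S"
  by (simp add: csubspace_scaleC scaleR_scaleC)

section \<open>Positive quadratic forms\<close>

lemma positive_form_subspace: "positive_form Q \<Longrightarrow> csubspace (dom Q)"
  and positive_form_nonneg: "positive_form Q \<Longrightarrow> x \<in> dom Q \<Longrightarrow> 0 \<le> the (Q x)"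
  by (auto simp: positive_form_def)

lemma closed_form_positive: "closed_form Q \<Longrightarrow> positive_form Q"
  by (simp add: closed_form_def)

lemmas form_closed = positive_form_subspace[THEN csubspace_add]
  positive_form_subspace[THEN csubspace_diff] positive_form_subspace[THEN csubspace_scaleC]
  positive_form_subspace[THEN csubspace_scaleR] positive_form_subspace[THEN csubspace_zero]

lemma positive_form_sesq:
  assumes "positive_form Q"
  shows "sesquilinear_on (dom Q) (sesq Q)"
    and "x \<in> dom Q \<Longrightarrow> sesq Q x x = complex_of_real (the (Q x))"
proof -
  from assms obtain s where D: "csubspace (dom Q)" and s: "sesquilinear_on (dom Q) s"
    and sQ: "\<And>u. u \<in> dom Q \<Longrightarrow> s u u = complex_of_real (the (Q u))"
    by (auto simp: positive_form_def)
  have eq: "sesq Q u v = s u v" if "u \<in> dom Q" "v \<in> dom Q" for u v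
    using sesq_unique[OF D s sQ that] .
  show "x \<in> dom Q \<Longrightarrow> sesq Q x x = complex_of_real (the (Q x))"
    by (simp add: eq sQ)
  have "x + y \<in> dom Q" "a *\<^sub>C x \<in> dom Q" if "x \<in> dom Q" "y \<in> dom Q" for x y a
    using D that by (auto simp: csubspace_def)
  then show "sesquilinear_on (dom Q) (sesq Q)"
    using s unfolding sesquilinear_on_def by (simp add: eq)
qed

lemma
  assumes "positive_form Q" "x \<in> dom Q" "y \<in> dom Q"
  shows sesq_add_left: "z \<in> dom Q \<Longrightarrow> sesq Q (x + y) z = sesq Q x z + sesq Q y z"
    and sesq_add_right: "z \<in> dom Q \<Longrightarrow> sesq Q z (x + y) = sesq Q z x + sesq Q z y"
    and sesq_scaleC_left: "sesq Q (a *\<^sub>C x) y = a * sesq Q x y"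
    and sesq_scaleC_right: "sesq Q x (a *\<^sub>C y) = cnj a * sesq Q x y"
  using positive_form_sesq(1)[OF assms(1)] assms(2,3) unfolding sesquilinear_on_def by auto

lemma sesq_diff_left:
  assumes "positive_form Q" "x \<in> dom Q" "y \<in> dom Q" "z \<in> dom Q"
  shows "sesq Q (x - y) z = sesq Q x z - sesq Q y z"
  using sesq_add_left[of Q "x - y" y z] assms by (simp add: form_closed)

lemma form_scaleC:
  assumes "positive_form Q" "x \<in> dom Q"
  shows "the (Q (a *\<^sub>C x)) = (cmod a)\<^sup>2 * the (Q x)"
proof -
  have ax: "a *\<^sub>C x \<in> dom Q" using assms by (simp add: form_closed)
  have "complex_of_real (the (Q (a *\<^sub>C x))) = sesq Q (a *\<^sub>C x) (a *\<^sub>C x)"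
    using positive_form_sesq(2)[OF assms(1) ax] by simp
  also have "\<dots> = a * (cnj a * sesq Q x x)"
    by (simp only: sesq_scaleC_left[OF assms(1,2) ax] sesq_scaleC_right[OF assms(1,2,2)])
  also have "\<dots> = complex_of_real ((cmod a)\<^sup>2 * the (Q x))"
    by (simp only: positive_form_sesq(2)[OF assms] of_real_mult complex_norm_square mult.assoc)
  finally show ?thesis by (simp only: of_real_eq_iff)
qed

lemma form_scaleR:
  assumes "positive_form Q" "x \<in> dom Q"
  shows "the (Q (r *\<^sub>R x)) = r\<^sup>2 * the (Q x)"
  using form_scaleC[OF assms, of "complex_of_real r"] by (simp add: scaleR_scaleC)

lemma form_minus:
  assumes "positive_form Q" "x \<in> dom Q"
  shows "the (Q (- x)) = the (Q x)"
  using form_scaleR[OF assms, of "- 1"] by simp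

lemma form_minus_commute:
  assumes "positive_form Q" "x \<in> dom Q" "y \<in> dom Q"
  shows "the (Q (x - y)) = the (Q (y - x))"
  using form_minus[OF assms(1), of "y - x"] assms by (simp add: form_closed)

text \<open>Real values on the diagonal force symmetry: the values at \<open>x + y\<close> and \<open>x + \<i>y\<close>
  being real, both \<open>s(x,y) + s(y,x)\<close> and \<open>\<i>(s(y,x) - s(x,y))\<close> are real.\<close>

lemma sesq_commute:
  assumes Q: "positive_form Q" and x: "x \<in> dom Q" and y: "y \<in> dom Q"
  shows "sesq Q y x = cnj (sesq Q x y)"
proof -
  have real: "Im (sesq Q x z + sesq Q z x) = 0" if z: "z \<in> dom Q" for z
  proof -
    have xz: "x + z \<in> dom Q" using Q x z by (simp add: form_closed)
    have "sesq Q (x + z) (x + z) = sesq Q x x + sesq Q z z + (sesq Q x z + sesq Q z x)"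
      using sesq_add_left[OF Q x z xz] sesq_add_right[OF Q x z x] sesq_add_right[OF Q x z z]
      by simp
    then show ?thesis
      using positive_form_sesq(2)[OF Q] x z xz
      by (metis Im_complex_of_real add.left_neutral plus_complex.simps(2))
  qed
  have iy: "\<i> *\<^sub>C y \<in> dom Q" using Q y by (simp add: form_closed)
  have "Im (- \<i> * sesq Q x y + \<i> * sesq Q y x) = 0"
    using real[OF iy] sesq_scaleC_right[OF Q x y, of \<i>] sesq_scaleC_left[OF Q y x, of \<i>] by simp
  then show ?thesis using real[OF y] by (simp add: complex_eq_iff)
qed

lemma form_add:
  assumes Q: "positive_form Q" and x: "x \<in> dom Q" and y: "y \<in> dom Q"
  shows "the (Q (x + y)) = the (Q x) + the (Q y) + 2 * Re (sesq Q x y)"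
proof -
  have xy: "x + y \<in> dom Q" using Q x y by (simp add: form_closed)
  have "sesq Q (x + y) (x + y) = sesq Q x x + sesq Q y y + (sesq Q x y + sesq Q y x)"
    using sesq_add_left[OF Q x y xy] sesq_add_right[OF Q x y x] sesq_add_right[OF Q x y y]
    by simp
  from arg_cong[OF this, of Re] show ?thesis
    using positive_form_sesq(2)[OF Q] x y xy sesq_commute[OF Q x y] by simp
qed

lemma form_parallelogram:
  assumes Q: "positive_form Q" and x: "x \<in> dom Q" and y: "y \<in> dom Q"
  shows "the (Q (x + y)) + the (Q (x - y)) = 2 * the (Q x) + 2 * the (Q y)"
proof -
  have "sesq Q x (- y) = - sesq Q x y"
    using sesq_scaleC_right[OF Q x y, of "- 1"] by (simp add: scaleC_minus_one)
  then show ?thesis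
    using form_add[OF Q x y] form_add[OF Q x, of "- y"] form_minus[OF Q y]
      csubspace_minus[OF positive_form_subspace[OF Q] y] by simp
qed

lemma form_cauchy_schwarz:
  assumes Q: "positive_form Q" and x: "x \<in> dom Q" and y: "y \<in> dom Q"
  shows "\<bar>Re (sesq Q x y)\<bar> \<le> sqrt (the (Q x)) * sqrt (the (Q y))"
proof -
  have quad: "0 \<le> the (Q x) + t\<^sup>2 * the (Q y) + 2 * t * Re (sesq Q x y)" for t
  proof -
    have ty: "t *\<^sub>R y \<in> dom Q" and xty: "x + t *\<^sub>R y \<in> dom Q"
      using Q x y by (simp_all add: form_closed)
    have "sesq Q x (t *\<^sub>R y) = t * sesq Q x y"
      using sesq_scaleC_right[OF Q x y, of "complex_of_real t"] by (simp add: scaleR_scaleC)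
    then show ?thesis
      using form_add[OF Q x ty] form_scaleR[OF Q y, of t] positive_form_nonneg[OF Q xty] by simp
  qed
  have nn: "0 \<le> the (Q x)" "0 \<le> the (Q y)" using Q x y by (simp_all add: positive_form_nonneg)
  have "(Re (sesq Q x y))\<^sup>2 \<le> the (Q x) * the (Q y)"
  proof (cases "the (Q y) = 0")
    case True
    have "Re (sesq Q x y) = 0"
    proof (rule ccontr)
      assume nz: "Re (sesq Q x y) \<noteq> 0"
      show False
        using quad[of "- (the (Q x) + 1) / (2 * Re (sesq Q x y))"] nz True by (simp add: field_simps)
    qed
    then show ?thesis using True by simp
  next
    case False
    then have "the (Q y) > 0" using nn by simp
    then show ?thesis
      using quad[of "- Re (sesq Q x y) / the (Q y)"] by (simp add: field_simps power2_eq_square)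
  qed
  then have "sqrt ((Re (sesq Q x y))\<^sup>2) \<le> sqrt (the (Q x) * the (Q y))"
    by (rule real_sqrt_le_mono)
  then show ?thesis by (simp add: real_sqrt_mult)
qed

text \<open>Convergence in the form seminorm implies convergence of the values, by the
  Cauchy--Schwarz inequality for the cross term in \<open>Q[u + (X\<^sub>n - u)]\<close>.\<close>

lemma form_tendsto:
  assumes Q: "positive_form Q" and X: "\<And>n. X n \<in> dom Q" and u: "u \<in> dom Q"
    and lim: "(\<lambda>n. the (Q (X n - u))) \<longlonglongrightarrow> 0"
  shows "(\<lambda>n. the (Q (X n))) \<longlonglongrightarrow> the (Q u)"
proof -
  have d: "X n - u \<in> dom Q" for n using Q X u by (simp add: form_closed)
  have bound: "norm (the (Q (X n)) - the (Q u))
      \<le> the (Q (X n - u)) + 2 * (sqrt (the (Q u)) * sqrt (the (Q (X n - u))))" for n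
  proof -
    have "the (Q (X n)) = the (Q u) + the (Q (X n - u)) + 2 * Re (sesq Q u (X n - u))"
      using form_add[OF Q u d] by simp
    then show ?thesis
      using form_cauchy_schwarz[OF Q u d] positive_form_nonneg[OF Q d, of n]
      unfolding real_norm_def by (smt (verit))
  qed
  have "(\<lambda>n. the (Q (X n - u)) + 2 * (sqrt (the (Q u)) * sqrt (the (Q (X n - u)))))
      \<longlonglongrightarrow> 0 + 2 * (sqrt (the (Q u)) * sqrt 0)"
    using lim by (intro tendsto_intros)
  then have "(\<lambda>n. the (Q (X n)) - the (Q u)) \<longlonglongrightarrow> 0"
    by (intro Lim_null_comparison[OF always_eventually, OF allI, OF bound]) simp
  then show ?thesis by (simp add: LIM_zero_iff)
qed

text \<open>A limit of positive forms is a positive form because the polarized sesquilinear forms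
  converge too. The relation \<open>approx\<close> allows the arguments to vary along the sequence.\<close>

lemma positive_form_limit:
  assumes Q: "\<And>n. positive_form (Q n)" and C: "csubspace (dom C)"
    and ex: "\<And>u. u \<in> dom C \<Longrightarrow> \<exists>w. approx w u"
    and dom: "\<And>w u n. approx w u \<Longrightarrow> w n \<in> dom (Q n)"
    and add: "\<And>w w' u u'. approx w u \<Longrightarrow> approx w' u' \<Longrightarrow> approx (\<lambda>n. w n + w' n) (u + u')"
    and scale: "\<And>w u a. approx w u \<Longrightarrow> approx (\<lambda>n. a *\<^sub>C w n) (a *\<^sub>C u)"
    and lim: "\<And>w u. approx w u \<Longrightarrow> (\<lambda>n. the (Q n (w n))) \<longlonglongrightarrow> the (C u)"
  shows "positive_form C"
proof -
  have slim: "(\<lambda>n. sesq (Q n) (w n) (w' n)) \<longlonglongrightarrow> sesq C u u'"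
    if "approx w u" "approx w' u'" for w w' u u'
    unfolding sesq_def
    by (intro tendsto_intros lim add scale that) auto
  have "sesq C (x + y) z = sesq C x z + sesq C y z \<and> sesq C z (x + y) = sesq C z x + sesq C z y"
    if xyz: "x \<in> dom C" "y \<in> dom C" "z \<in> dom C" for x y z
  proof -
    obtain wx wy wz where w: "approx wx x" "approx wy y" "approx wz z"
      using xyz[THEN ex] by blast
    note wxy = add[OF w(1,2)]
    note ds = w[THEN dom]
    show ?thesis
      using LIMSEQ_unique[OF slim[OF wxy w(3)]] LIMSEQ_unique[OF slim[OF w(3) wxy]]
        tendsto_add[OF slim[OF w(1,3)] slim[OF w(2,3)]]
        tendsto_add[OF slim[OF w(3,1)] slim[OF w(3,2)]]
      by (simp add: sesq_add_left[OF Q ds] sesq_add_right[OF Q ds])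
  qed
  moreover have "sesq C (a *\<^sub>C x) y = a * sesq C x y \<and> sesq C x (a *\<^sub>C y) = cnj a * sesq C x y"
    if xy: "x \<in> dom C" "y \<in> dom C" for x y a
  proof -
    obtain wx wy where w: "approx wx x" "approx wy y" using xy[THEN ex] by blast
    note ds = w[THEN dom]
    show ?thesis
      using LIMSEQ_unique[OF slim[OF scale[OF w(1)] w(2)]]
        LIMSEQ_unique[OF slim[OF w(1) scale[OF w(2)]]]
        tendsto_mult_left[OF slim[OF w]]
      by (simp add: sesq_scaleC_left[OF Q ds] sesq_scaleC_right[OF Q ds])
  qed
  moreover have "sesq C u u = complex_of_real (the (C u)) \<and> 0 \<le> the (C u)" if "u \<in> dom C" for u
  proof -
    obtain w where w: "approx w u" using ex[OF \<open>u \<in> dom C\<close>] by blast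
    have "(\<lambda>n. complex_of_real (the (Q n (w n)))) \<longlonglongrightarrow> complex_of_real (the (C u))"
      by (intro tendsto_intros lim w)
    moreover have "(\<lambda>n. complex_of_real (the (Q n (w n)))) \<longlonglongrightarrow> sesq C u u"
      using slim[OF w w] by (simp add: positive_form_sesq(2)[OF Q dom[OF w]])
    moreover have "0 \<le> the (C u)"
      by (rule LIMSEQ_le_const[OF lim[OF w]]) (use positive_form_nonneg[OF Q dom[OF w]] in auto)
    ultimately show ?thesis by (metis LIMSEQ_unique)
  qed
  ultimately show ?thesis
    unfolding positive_form_def sesquilinear_on_def using C by blast
qed

section \<open>Minimization\<close>

text \<open>For \<open>f = 0\<close> this is the shifted form; for \<open>a = 1\<close> its minimizer is \<open>(H + 1)\<^sup>-\<^sup>1 f\<close>, where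
  \<open>H\<close> is the operator of \<open>Q\<close>. Existence of trace lifts, the representation theorem and
  convergence of resolvents are therefore statements about one functional.\<close>

definition penalized :: "('a::chilbert \<rightharpoonup> real) \<Rightarrow> real \<Rightarrow> 'a \<Rightarrow> 'a \<Rightarrow> real" where
  "penalized Q a f w = the (Q w) + a * (norm (w - f))\<^sup>2"

text \<open>The parallelogram law as a measure of uniform convexity; the penalty point \<open>f\<close> drops
  out of the difference.\<close>

lemma penalized_midpoint:
  assumes Q: "positive_form Q" and x: "x \<in> dom Q" and y: "y \<in> dom Q"
  shows "the (Q (x - y)) + a * (norm (x - y))\<^sup>2
    = 2 * penalized Q a f x + 2 * penalized Q a f y - 4 * penalized Q a f ((1/2) *\<^sub>R (x + y))"
proof -
  have xy: "x + y \<in> dom Q" using Q x y by (simp add: form_closed)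
  have "4 * (norm ((1/2) *\<^sub>R (x + y) - f))\<^sup>2 = (norm ((x - f) + (y - f)))\<^sup>2"
  proof -
    have "(x - f) + (y - f) = 2 *\<^sub>R ((1/2) *\<^sub>R (x + y) - f)"
      by (simp add: scaleR_right_diff_distrib scaleR_2)
    then show ?thesis by (simp add: power_mult_distrib)
  qed
  moreover have "(norm ((x - f) + (y - f)))\<^sup>2 + (norm (x - y))\<^sup>2
      = 2 * (norm (x - f))\<^sup>2 + 2 * (norm (y - f))\<^sup>2"
    by (simp add: power2_norm_eq_inner inner_simps inner_commute)
  ultimately have n: "4 * (norm ((1/2) *\<^sub>R (x + y) - f))\<^sup>2
      = 2 * (norm (x - f))\<^sup>2 + 2 * (norm (y - f))\<^sup>2 - (norm (x - y))\<^sup>2"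
    by simp
  have q: "4 * the (Q ((1/2) *\<^sub>R (x + y))) = 2 * the (Q x) + 2 * the (Q y) - the (Q (x - y))"
    using form_scaleR[OF Q xy, of "1/2"] form_parallelogram[OF Q x y]
    by (simp add: power2_eq_square)
  have "4 * penalized Q a f ((1/2) *\<^sub>R (x + y))
      = 4 * the (Q ((1/2) *\<^sub>R (x + y))) + a * (4 * (norm ((1/2) *\<^sub>R (x + y) - f))\<^sup>2)"
    by (simp add: penalized_def)
  then show ?thesis unfolding q n penalized_def by (simp add: algebra_simps)
qed

text \<open>The parallelogram law makes near-minimizers over shrinking midpoint-convex sets a Cauchy
  sequence: the midpoint of two of them lies in the larger set, so its value is at least the
  infimum there. A constant sequence \<open>S\<close> gives existence of minimizers; balls shrinking to a
  point give lower semicontinuity.\<close>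

lemma nested_minimization:
  fixes Q :: "'a::chilbert \<rightharpoonup> real"
  assumes Qc: "closed_form Q" and a: "a > 0" and S: "decseq S" "\<And>n. S n \<subseteq> dom Q"
    and mid: "\<And>n x y. x \<in> S n \<Longrightarrow> y \<in> S n \<Longrightarrow> (1/2) *\<^sub>R (x + y) \<in> S n"
    and b: "\<And>n. \<exists>w\<in>S n. penalized Q a f w \<le> b"
  obtains X u where "\<And>n. X n \<in> S n" "X \<longlonglongrightarrow> u" "u \<in> dom Q"
    "(\<lambda>n. the (Q (X n - u))) \<longlonglongrightarrow> 0"
    "\<And>c. (\<And>n. \<exists>w\<in>S n. penalized Q a f w \<le> c) \<Longrightarrow> penalized Q a f u \<le> c"
proof -
  note Q = closed_form_positive[OF Qc]
  define F where "F = penalized Q a f"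
  define d where "d n = Inf (F ` S n)" for n
  have F0: "0 \<le> F w" if "w \<in> S n" for w n
    using that S(2) a positive_form_nonneg[OF Q] unfolding F_def penalized_def
    by (intro add_nonneg_nonneg) auto
  have bdd: "bdd_below (F ` S n)" for n using F0 by (intro bdd_belowI[of _ 0]) auto
  have ne: "F ` S n \<noteq> {}" for n using b[of n] by auto
  have dle: "d n \<le> F w" if "w \<in> S n" for w n
    unfolding d_def using that bdd by (auto intro: cInf_lower)
  have dlec: "d n \<le> c" if "\<And>n. \<exists>w\<in>S n. F w \<le> c" for c n
    using that[of n] dle[of _ n] by (meson order_trans)
  have "incseq d"
    unfolding d_def incseq_def
    by (intro allI impI cInf_superset_mono ne bdd image_mono) (use S(1) in \<open>simp add: decseq_def\<close>)
  then obtain L where L: "d \<longlonglongrightarrow> L" "\<And>n. d n \<le> L"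
    using incseq_convergent[of d b] dlec[of b] b unfolding F_def by blast
  have "\<exists>w\<in>S n. F w < d n + 1 / Suc n" for n
    using cInf_lessD[OF ne[of n], of "d n + 1 / Suc n"] unfolding d_def by auto
  then obtain X where X: "\<And>n. X n \<in> S n" "\<And>n. F (X n) < d n + 1 / Suc n" by metis
  have XQ: "X n \<in> dom Q" for n using X(1) S(2) by blast
  define D where "D m n = the (Q (X m - X n)) + a * (norm (X m - X n))\<^sup>2" for m n
  define r where "r m = 2 * (L - d m) + 4 / real (Suc m)" for m
  \<comment> \<open>the midpoint of \<open>X m\<close> and \<open>X n\<close> lies in \<open>S m\<close>, where no value is below \<open>d m\<close>\<close>
  have D_le: "D m n \<le> r m" if "m \<le> n" for m n
  proof -
    have "X n \<in> S m" using S(1) X(1) that by (auto simp: decseq_def)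
    then have "d m \<le> F ((1/2) *\<^sub>R (X m + X n))" using dle mid X(1) by blast
    moreover have "1 / real (Suc n) \<le> 1 / real (Suc m)" using that by (simp add: frac_le)
    ultimately have "F (X n) \<le> L + 1 / real (Suc m)" "d m \<le> F ((1/2) *\<^sub>R (X m + X n))"
      using X(2)[of n] L(2)[of n] by auto
    then have "D m n \<le> 2 * (d m + 1 / real (Suc m)) + 2 * (L + 1 / real (Suc m)) - 4 * d m"
      using penalized_midpoint[OF Q XQ[of m] XQ[of n], of a f] X(2)[of m]
      unfolding F_def D_def by argo
    then show ?thesis by (simp add: r_def algebra_simps)
  qed
  have "(\<lambda>m. 2 * (L - d m) + 4 * (1 / real (Suc m))) \<longlonglongrightarrow> 2 * (L - L) + 4 * 0"
    using L(1) by (intro tendsto_intros LIMSEQ_Suc lim_inverse_n'[unfolded inverse_eq_divide]) auto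
  then have "r \<longlonglongrightarrow> 0" unfolding r_def by simp
  have D_sym: "D m n = D n m" for m n
    unfolding D_def using form_minus_commute[OF Q XQ XQ] by (simp add: norm_minus_commute)
  have cauchy: "\<exists>N. \<forall>m\<ge>N. \<forall>n\<ge>N. D m n < e" if e: "e > 0" for e
  proof -
    obtain N where N: "\<And>m. m \<ge> N \<Longrightarrow> r m < e"
      using order_tendstoD(2)[OF \<open>r \<longlonglongrightarrow> 0\<close> e] by (auto simp: eventually_sequentially)
    have "D m n < e" if "m \<ge> N" "n \<ge> N" for m n
      using le_less_trans[OF D_le N, of m n] le_less_trans[OF D_le N, of n m] D_sym[of m n] that
      by (cases m n rule: linorder_le_cases) auto
    then show ?thesis by blast
  qed
  have D_ge: "the (Q (X m - X n)) \<le> D m n" "a * (norm (X m - X n))\<^sup>2 \<le> D m n" for m n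
    using a positive_form_nonneg[OF Q, of "X m - X n"] Q XQ by (simp_all add: D_def form_closed)
  have "Cauchy X"
  proof (rule CauchyI)
    fix e :: real assume e: "e > 0"
    then obtain N where N: "\<And>m n. m \<ge> N \<Longrightarrow> n \<ge> N \<Longrightarrow> D m n < a * e\<^sup>2"
      using cauchy[of "a * e\<^sup>2"] a by auto
    have "norm (X m - X n) < e" if "m \<ge> N" "n \<ge> N" for m n
    proof -
      have "a * (norm (X m - X n))\<^sup>2 < a * e\<^sup>2" using N[OF that] D_ge(2) by (rule le_less_trans[rotated])
      then show ?thesis using a e by (simp add: power_less_imp_less_base)
    qed
    then show "\<exists>N. \<forall>m\<ge>N. \<forall>n\<ge>N. norm (X m - X n) < e" by blast
  qed
  then obtain u where u: "X \<longlonglongrightarrow> u" using convergent_eq_Cauchy by blast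
  have "\<exists>N. \<forall>m\<ge>N. \<forall>n\<ge>N. the (Q (X m - X n)) < e" if "e > 0" for e
    using cauchy[OF that] D_ge(1) le_less_trans by blast
  then have uQ: "u \<in> dom Q" and lim: "(\<lambda>n. the (Q (X n - u))) \<longlonglongrightarrow> 0"
    using Qc XQ u unfolding closed_form_def by blast+
  have "(\<lambda>n. F (X n)) \<longlonglongrightarrow> F u"
    unfolding F_def penalized_def by (intro tendsto_intros u form_tendsto[OF Q XQ uQ lim])
  moreover have "(\<lambda>n. d n + 1 / real (Suc n)) \<longlonglongrightarrow> L + 0"
    by (intro tendsto_intros L LIMSEQ_Suc lim_inverse_n'[unfolded inverse_eq_divide])
  ultimately have "F u \<le> L + 0"
    by (rule LIMSEQ_le) (use X(2) less_imp_le in blast)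
  moreover have "L \<le> c" if "\<And>n. \<exists>w\<in>S n. F w \<le> c" for c
    using LIMSEQ_le_const2[OF L(1)] dlec that by blast
  ultimately have "F u \<le> c" if "\<And>n. \<exists>w\<in>S n. F w \<le> c" for c
    using that by fastforce
  then show thesis
    using that[OF X(1) u uQ lim] unfolding F_def by blast
qed

text \<open>A minimizer over \<open>u + V\<close> satisfies the Euler equation on \<open>V\<close>; the test vectors \<open>t z v\<close>
  with \<open>t < 0\<close> real and \<open>z\<close> the value in question show \<open>z = 0\<close>.\<close>

lemma euler_equation:
  assumes Q: "positive_form Q" and u: "u \<in> dom Q" and V: "csubspace V" "V \<subseteq> dom Q"
    and min: "\<And>v. v \<in> V \<Longrightarrow> penalized Q a f u \<le> penalized Q a f (u + v)" and v: "v \<in> V"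
  shows "sesq Q u v + a * cinner (u - f) v = 0"
proof (rule ccontr)
  define z where "z = sesq Q u v + a * cinner (u - f) v"
  \<comment> \<open>bounds the quadratic coefficient, so that at \<open>t = - 1 / b\<close> the linear term wins\<close>
  define b where "b = \<bar>the (Q v) + a * (norm v)\<^sup>2\<bar> + 1"
  define t where "t = - 1 / b"
  define c where "c = complex_of_real t * z"
  assume "sesq Q u v + a * cinner (u - f) v \<noteq> 0"
  then have z: "cmod z > 0" by (simp add: z_def)
  have vQ: "v \<in> dom Q" and cv: "c *\<^sub>C v \<in> V" "c *\<^sub>C v \<in> dom Q"
    using V v by (auto intro: csubspace_scaleC)
  have expand: "(norm (u + c *\<^sub>C v - f))\<^sup>2
      = (norm (u - f))\<^sup>2 + (cmod c)\<^sup>2 * (norm v)\<^sup>2 + 2 * Re (cnj c * cinner (u - f) v)"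
  proof -
    have "(norm ((u - f) + c *\<^sub>C v))\<^sup>2
        = (norm (u - f))\<^sup>2 + (norm (c *\<^sub>C v))\<^sup>2 + 2 * ((u - f) \<bullet> (c *\<^sub>C v))"
      by (simp add: power2_norm_eq_inner inner_simps inner_commute)
    then show ?thesis
      by (simp add: norm_scaleC power_mult_distrib inner_eq_Re_cinner cinner_scaleC_right
          algebra_simps)
  qed
  have "penalized Q a f (u + c *\<^sub>C v) - penalized Q a f u
      = (cmod c)\<^sup>2 * (the (Q v) + a * (norm v)\<^sup>2) + 2 * Re (cnj c * z)"
    unfolding penalized_def expand form_add[OF Q u cv(2)] form_scaleC[OF Q vQ]
      sesq_scaleC_right[OF Q u vQ] z_def
    by (simp add: algebra_simps)
  moreover have "Re (cnj c * z) = t * (cmod z)\<^sup>2"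
    unfolding c_def cmod_power2 by (simp add: power2_eq_square algebra_simps)
  moreover have "(cmod c)\<^sup>2 = t\<^sup>2 * (cmod z)\<^sup>2"
    by (simp add: c_def norm_mult power_mult_distrib)
  ultimately have "0 \<le> (cmod z)\<^sup>2 * (t\<^sup>2 * (the (Q v) + a * (norm v)\<^sup>2) + 2 * t)"
    using min[OF cv(1)] by (simp add: algebra_simps)
  then have "0 \<le> t\<^sup>2 * (the (Q v) + a * (norm v)\<^sup>2) + 2 * t"
    using z by (simp add: zero_le_mult_iff)
  also have "\<dots> \<le> t\<^sup>2 * b + 2 * t"
    by (intro add_right_mono mult_left_mono) (auto simp: b_def)
  also have "\<dots> < 0"
    unfolding t_def using b_def by (simp add: power2_eq_square field_simps)
  finally show False by simp
qed

text \<open>Closed forms are lower semicontinuous: the near-minimizers over balls shrinking to \<open>u\<close>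
  converge to \<open>u\<close>, and they are Cauchy in the form norm. Passing through a bound \<open>c\<close> also
  shows that the form domain contains every limit of points with bounded values.\<close>

lemma closed_form_lsc:
  assumes Qc: "closed_form Q"
    and c: "\<And>e. e > 0 \<Longrightarrow> \<exists>w\<in>dom Q. norm (w - u) < e \<and> the (Q w) < c + e"
  shows "u \<in> dom Q" and "the (Q u) \<le> c"
proof -
  note Q = closed_form_positive[OF Qc]
  define S where "S n = {w \<in> dom Q. norm (w - u) \<le> 1 / Suc n}" for n
  have "u \<in> dom Q \<and> the (Q u) \<le> c + e" if e: "e > 0" for e
  proof -
    have dec: "decseq S"
    proof (rule decseq_SucI)
      fix n
      have "1 / real (Suc (Suc n)) \<le> 1 / real (Suc n)" by (simp add: frac_le)
      then show "S (Suc n) \<subseteq> S n" unfolding S_def by force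
    qed
    have mid: "(1/2) *\<^sub>R (x + y) \<in> S n" if "x \<in> S n" "y \<in> S n" for x y n
    proof -
      have "(1/2) *\<^sub>R (x + y) - u = (1/2) *\<^sub>R ((x - u) + (y - u))"
      proof -
        have "(x - u) + (y - u) = (x + y) - 2 *\<^sub>R u" by (simp add: scaleR_2)
        then show ?thesis by (simp only: scaleR_right_diff_distrib) simp
      qed
      then have "norm ((1/2) *\<^sub>R (x + y) - u) \<le> (norm (x - u) + norm (y - u)) / 2"
        using norm_triangle_ineq[of "x - u" "y - u"] by simp
      then show ?thesis using that Q by (auto simp: S_def form_closed)
    qed
    have near: "\<exists>w\<in>S n. penalized Q 1 u w \<le> c + e" for n
    proof -
      \<comment> \<open>small enough for \<open>h + h\<^sup>2 \<le> e\<close>: the excess of the value plus the penalty\<close>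
      define h where "h = min (min (e / 2) 1) (1 / Suc n)"
      have h: "h > 0" "h \<le> e / 2" "h \<le> 1" "h \<le> 1 / Suc n" using e by (auto simp: h_def)
      obtain w where w: "w \<in> dom Q" "norm (w - u) < h" "the (Q w) < c + h" using c[OF h(1)] by blast
      have "(norm (w - u))\<^sup>2 \<le> h * 1"
        unfolding power2_eq_square using w(2) h by (intro mult_mono) auto
      then have "penalized Q 1 u w \<le> c + e" using w(3) h(2) by (simp add: penalized_def)
      moreover have "w \<in> S n" using w h(4) by (simp add: S_def)
      ultimately show ?thesis by blast
    qed
    obtain X x where X: "\<And>n. X n \<in> S n" "X \<longlonglongrightarrow> x" "x \<in> dom Q"
      and le: "\<And>c. (\<And>n. \<exists>w\<in>S n. penalized Q 1 u w \<le> c) \<Longrightarrow> penalized Q 1 u x \<le> c"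
    proof (rule nested_minimization[OF Qc, of 1 S u "c + e"])
      show "S n \<subseteq> dom Q" for n by (auto simp: S_def)
    qed (use dec mid near in auto)
    have "(\<lambda>n. X n - u) \<longlonglongrightarrow> 0"
      by (rule Lim_null_comparison[OF always_eventually lim_inverse_n'[THEN LIMSEQ_Suc]])
        (use X(1) in \<open>auto simp: S_def inverse_eq_divide\<close>)
    then have "x = u" using X(2) LIMSEQ_unique LIM_zero_iff by blast
    then show ?thesis using X(3) le[OF near] by (simp add: penalized_def)
  qed
  note * = this
  show "u \<in> dom Q" using *[OF zero_less_one] by (rule conjunct1)
  show "the (Q u) \<le> c" by (rule field_le_epsilon) (rule *[THEN conjunct2])
qed

section \<open>The operator associated with a closed form\<close>

definition minimizer :: "('a::chilbert \<rightharpoonup> real) \<Rightarrow> real \<Rightarrow> 'a \<Rightarrow> 'a" where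
  "minimizer Q a f = (SOME u. u \<in> dom Q \<and> (\<forall>w\<in>dom Q. penalized Q a f u \<le> penalized Q a f w))"

lemma minimizer:
  assumes Qc: "closed_form Q" and a: "a > 0"
  shows "minimizer Q a f \<in> dom Q"
    and "w \<in> dom Q \<Longrightarrow> penalized Q a f (minimizer Q a f) \<le> penalized Q a f w"
proof -
  note Q = closed_form_positive[OF Qc]
  obtain X u where u: "u \<in> dom Q"
    "\<And>c. (\<And>n::nat. \<exists>w\<in>dom Q. penalized Q a f w \<le> c) \<Longrightarrow> penalized Q a f u \<le> c"
  proof (rule nested_minimization[OF Qc a, of "\<lambda>_. dom Q" f "penalized Q a f 0"])
    show "\<exists>w\<in>dom Q. penalized Q a f w \<le> penalized Q a f 0"
      using form_closed(5)[OF Q] by blast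
  qed (use Q in \<open>auto simp: form_closed\<close>)
  then have "\<exists>u. u \<in> dom Q \<and> (\<forall>w\<in>dom Q. penalized Q a f u \<le> penalized Q a f w)"
    by blast
  from someI_ex[OF this] show "minimizer Q a f \<in> dom Q"
    and "w \<in> dom Q \<Longrightarrow> penalized Q a f (minimizer Q a f) \<le> penalized Q a f w"
    by (auto simp: minimizer_def)
qed

text \<open>The Euler equation says that \<open>minimizer Q a f\<close> lies in the domain of the operator of \<open>Q\<close>,
  which maps it to \<open>a (f - minimizer Q a f)\<close>.\<close>

lemma minimizer_weak_equation:
  assumes Qc: "closed_form Q" and a: "a > 0" and v: "v \<in> dom Q"
  shows "sesq Q (minimizer Q a f) v = cinner (a *\<^sub>C (f - minimizer Q a f)) v"
proof -
  note Q = closed_form_positive[OF Qc]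
  have "sesq Q (minimizer Q a f) v + a * cinner (minimizer Q a f - f) v = 0"
    by (rule euler_equation[OF Q minimizer(1)[OF Qc a] positive_form_subspace[OF Q] order_refl _ v])
      (use Q minimizer[OF Qc a] in \<open>simp add: form_closed\<close>)
  then show ?thesis
    unfolding cinner_scaleC_left cinner_diff_left right_diff_distrib by (simp add: algebra_simps)
qed

lemma form_operator_eq_Some_iff:
  assumes D: "densely_defined Q"
  shows "form_operator Q u = Some g \<longleftrightarrow> u \<in> dom Q \<and> (\<forall>v\<in>dom Q. sesq Q u v = cinner g v)"
proof -
  have uniq: "g = g'" if g: "\<forall>v\<in>dom Q. sesq Q u v = cinner g v"
      and g': "\<forall>v\<in>dom Q. sesq Q u v = cinner g' v" for g g'
  proof (rule cinner_dense_eq)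
    show "closure (dom Q) = UNIV" using D by (simp add: densely_defined_def)
    show "cinner g v = cinner g' v" if "v \<in> dom Q" for v
      by (rule trans[OF bspec[OF g that, symmetric] bspec[OF g' that]])
  qed
  have the_eq: "(THE f. \<forall>v\<in>dom Q. sesq Q u v = cinner f v) = g'"
    if "\<forall>v\<in>dom Q. sesq Q u v = cinner g' v" for g'
    by (rule the_equality[where P = "\<lambda>f. \<forall>v\<in>dom Q. sesq Q u v = cinner f v", OF that])
      (rule uniq[OF _ that])
  show ?thesis
  proof (cases "u \<in> dom Q \<and> (\<exists>f. \<forall>v\<in>dom Q. sesq Q u v = cinner f v)")
    case True
    then obtain g' where g': "\<forall>v\<in>dom Q. sesq Q u v = cinner g' v" by blast
    have "form_operator Q u = Some g'"
      unfolding form_operator_def the_eq[OF g'] using True by (rule if_P)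
    moreover have "g = g' \<longleftrightarrow> (\<forall>v\<in>dom Q. sesq Q u v = cinner g v)"
      using g' uniq[OF _ g'] by blast
    ultimately show ?thesis using True by (simp only: option.inject) blast
  next
    case False
    then have "form_operator Q u = None" unfolding form_operator_def by (rule if_not_P)
    then show ?thesis using False by force
  qed
qed

text \<open>The range of \<open>H + 1\<close> is the whole space by the Euler equation with \<open>a = 1\<close>. It is injective
  since the difference \<open>d\<close> of two solutions satisfies \<open>Q[d] = - \<parallel>d\<parallel>\<^sup>2\<close>.\<close>

lemma form_operator_add_one_eq_iff:
  assumes Qc: "closed_form Q" and D: "densely_defined Q"
  shows "x \<in> dom (form_operator Q) \<and> the (form_operator Q x) + x = f \<longleftrightarrow> x = minimizer Q 1 f"
proof -
  note Q = closed_form_positive[OF Qc]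
  let ?m = "minimizer Q 1 f"
  have m: "form_operator Q ?m = Some (f - ?m)"
    using minimizer_weak_equation[OF Qc, of 1 _ f] minimizer(1)[OF Qc, of 1 f]
    by (simp add: form_operator_eq_Some_iff[OF D] scaleR_scaleC[of 1, simplified, symmetric])
  have "x = ?m" if "form_operator Q x = Some (f - x)"
  proof -
    have x: "x \<in> dom Q" "\<And>v. v \<in> dom Q \<Longrightarrow> sesq Q x v = cinner (f - x) v"
      using that by (auto simp: form_operator_eq_Some_iff[OF D])
    have m': "?m \<in> dom Q" "\<And>v. v \<in> dom Q \<Longrightarrow> sesq Q ?m v = cinner (f - ?m) v"
      using m by (auto simp: form_operator_eq_Some_iff[OF D])
    have d: "x - ?m \<in> dom Q" using Q x m' by (simp add: form_closed)
    have "sesq Q (x - ?m) (x - ?m) = cinner ((f - x) - (f - ?m)) (x - ?m)"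
      using sesq_diff_left[OF Q x(1) m'(1) d] x(2)[OF d] m'(2)[OF d]
      by (simp only: cinner_diff_left)
    also have "\<dots> = - cinner (x - ?m) (x - ?m)" by (simp add: cinner_minus_left[symmetric])
    finally have "complex_of_real (the (Q (x - ?m))) = complex_of_real (- (norm (x - ?m))\<^sup>2)"
      using positive_form_sesq(2)[OF Q d] by (simp add: cinner_self)
    then have "the (Q (x - ?m)) = - (norm (x - ?m))\<^sup>2" by (simp only: of_real_eq_iff)
    then have "(norm (x - ?m))\<^sup>2 \<le> 0" using positive_form_nonneg[OF Q d] by linarith
    then show ?thesis by simp
  qed
  moreover have "x \<in> dom (form_operator Q) \<and> the (form_operator Q x) + x = f
      \<longleftrightarrow> form_operator Q x = Some (f - x)"
    by (auto simp: algebra_simps)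
  ultimately show ?thesis using m by auto
qed

lemma inv_plus_one_form_operator:
  assumes "closed_form Q" "densely_defined Q"
  shows "inv_plus_one (form_operator Q) f = minimizer Q 1 f"
  unfolding inv_plus_one_def form_operator_add_one_eq_iff[OF assms] by simp

text \<open>The minimizers of \<open>Q[w] + n \<parallel>w - u\<parallel>\<^sup>2\<close> lie in the operator domain and approximate
  \<open>u \<in> dom Q\<close>, since \<open>n \<parallel>w - u\<parallel>\<^sup>2 \<le> Q[u]\<close>.\<close>

lemma form_operator_densely_defined:
  assumes Qc: "closed_form Q" and D: "densely_defined Q"
  shows "densely_defined (form_operator Q)"
proof -
  note Q = closed_form_positive[OF Qc]
  have "u \<in> closure (dom (form_operator Q))" if u: "u \<in> dom Q" for u
    unfolding closure_approachable
  proof (intro allI impI)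
    fix e :: real assume e: "e > 0"
    define a where "a = the (Q u) / e\<^sup>2 + 1"
    have a: "a > 0" unfolding a_def using positive_form_nonneg[OF Q u] by (intro add_nonneg_pos) auto
    let ?m = "minimizer Q a u"
    have m: "?m \<in> dom Q" by (rule minimizer(1)[OF Qc a])
    have "form_operator Q ?m = Some (a *\<^sub>C (u - ?m))"
      using minimizer_weak_equation[OF Qc a] m by (simp add: form_operator_eq_Some_iff[OF D])
    moreover have "norm (?m - u) < e"
    proof -
      have "a * (norm (?m - u))\<^sup>2 \<le> the (Q u)"
        using minimizer(2)[OF Qc a u, of u] positive_form_nonneg[OF Q m]
        by (simp add: penalized_def)
      also have "\<dots> < a * e\<^sup>2" using e by (simp add: a_def field_simps)
      finally show ?thesis using a e by (simp add: power_less_imp_less_base)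
    qed
    ultimately show "\<exists>y\<in>dom (form_operator Q). dist y u < e" by (auto simp: dist_norm)
  qed
  then have "closure (dom Q) \<subseteq> closure (dom (form_operator Q))" by (intro closure_minimal) auto
  then show ?thesis using D by (auto simp: densely_defined_def)
qed

text \<open>A symmetric operator \<open>T\<close> with \<open>T + 1\<close> surjective is self-adjoint: if \<open>T\<^sup>* y = z\<close>, then the
  solution \<open>w\<close> of \<open>(T + 1) w = z + y\<close> satisfies \<open>\<langle>(T + 1) x, y\<rangle> = \<langle>(T + 1) x, w\<rangle>\<close> for all
  \<open>x\<close>, whence \<open>y = w\<close>.\<close>

lemma positive_self_adjoint_form_operator:
  assumes Qc: "closed_form Q" and D: "densely_defined Q"
  shows "positive_self_adjoint (form_operator Q)"
proof -
  note Q = closed_form_positive[OF Qc]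
  note iff = form_operator_eq_Some_iff[OF D]
  define T where "T = form_operator Q"
  have T: "x \<in> dom Q" "v \<in> dom Q \<Longrightarrow> sesq Q x v = cinner (the (T x)) v" if x: "x \<in> dom T" for x v
  proof -
    obtain g where "form_operator Q x = Some g" using x unfolding T_def by blast
    then have g: "T x = Some g" "x \<in> dom Q \<and> (\<forall>v\<in>dom Q. sesq Q x v = cinner g v)"
      unfolding T_def iff by simp_all
    show "x \<in> dom Q" using g(2) by (rule conjunct1)
    show "v \<in> dom Q \<Longrightarrow> sesq Q x v = cinner (the (T x)) v" using g by simp
  qed
  have TI: "T x = Some g" if "x \<in> dom Q" "\<And>v. v \<in> dom Q \<Longrightarrow> sesq Q x v = cinner g v" for x g
    using that iff unfolding T_def by blast
  have lin: "linear_operator T"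
    unfolding linear_operator_def
  proof (intro conjI ballI allI)
    have add: "T (x + y) = Some (the (T x) + the (T y))" if "x \<in> dom T" "y \<in> dom T" for x y
      using T[OF that(1)] T[OF that(2)] Q
      by (intro TI) (auto simp: form_closed sesq_add_left cinner_add_left)
    have scale: "T (a *\<^sub>C x) = Some (a *\<^sub>C the (T x))" if "x \<in> dom T" for x a
      using T[OF that] Q
      by (intro TI) (auto simp: form_closed sesq_scaleC_left cinner_scaleC_left)
    have "T 0 = Some 0"
    proof (rule TI)
      show "0 \<in> dom Q" using Q by (simp add: form_closed)
      show "sesq Q 0 v = cinner 0 v" if "v \<in> dom Q" for v
        using sesq_diff_left[OF Q that that that] cinner_diff_left[of v v v] by simp
    qed
    then show "csubspace (dom T)" unfolding csubspace_def using add scale by blast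
    show "T (x + y) = Some (the (T x) + the (T y))" if "x \<in> dom T" "y \<in> dom T" for x y
      by (rule add[OF that])
    show "T (a *\<^sub>C x) = Some (a *\<^sub>C the (T x))" if "x \<in> dom T" for x a by (rule scale[OF that])
  qed
  have dense: "densely_defined T"
    unfolding T_def by (rule form_operator_densely_defined[OF Qc D])
  have sym: "cinner (the (T x)) y = cinner x (the (T y))" if "x \<in> dom T" "y \<in> dom T" for x y
    using T[OF that(1)] T[OF that(2)] sesq_commute[OF Q, of y x]
    by (metis cinner_commute)
  have surj: "\<exists>w\<in>dom T. the (T w) + w = f" for f
    using form_operator_add_one_eq_iff[OF Qc D, of _ f] unfolding T_def by blast
  have adj: "y \<in> dom T \<and> the (T y) = z" if "\<forall>x\<in>dom T. cinner (the (T x)) y = cinner x z" for y z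
  proof -
    obtain w where w: "w \<in> dom T" "the (T w) + w = z + y" using surj by blast
    \<comment> \<open>test \<open>y - w\<close> against itself\<close>
    obtain x where x: "x \<in> dom T" "the (T x) + x = y - w" using surj by blast
    have "cinner (the (T x) + x) y = cinner x (z + y)"
      using that x(1) by (simp add: cinner_add_left cinner_add_right)
    also have "\<dots> = cinner (the (T x) + x) w"
      using sym[OF x(1) w(1)] by (simp add: cinner_add_left cinner_add_right flip: w(2))
    finally have "cinner (y - w) (y - w) = 0" by (simp add: x(2) cinner_diff_right)
    then have "y = w" by (simp add: cinner_self)
    then show ?thesis using w by auto
  qed
  have "adjoint_op T y = T y" for y
  proof (cases "y \<in> dom T")
    case True
    have ex: "\<forall>x\<in>dom T. cinner (the (T x)) y = cinner x (the (T y))" using sym True by blast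
    have "(THE z. \<forall>x\<in>dom T. cinner (the (T x)) y = cinner x z) = the (T y)"
      by (rule the_equality[where P = "\<lambda>z. \<forall>x\<in>dom T. cinner (the (T x)) y = cinner x z", OF ex])
        (rule adj[THEN conjunct2, symmetric])
    then have "adjoint_op T y = Some (the (T y))"
      unfolding adjoint_op_def using ex by (simp only: if_P[OF exI[of _ "the (T y)"]])
    then show ?thesis using True by auto
  next
    case False
    then have "\<nexists>z. \<forall>x\<in>dom T. cinner (the (T x)) y = cinner x z" using adj by blast
    then have "adjoint_op T y = None" unfolding adjoint_op_def by (rule if_not_P)
    then show ?thesis using False by (simp add: domIff)
  qed
  moreover have "0 \<le> Re (cinner (the (T x)) x)" if "x \<in> dom T" for x
    using T(2)[OF that T(1)[OF that]] positive_form_sesq(2)[OF Q T(1)[OF that]]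
      positive_form_nonneg[OF Q T(1)[OF that]]
    by (metis Re_complex_of_real)
  ultimately show ?thesis
    using lin dense unfolding positive_self_adjoint_def self_adjoint_def T_def[symmetric] by blast
qed

section \<open>The lower semicontinuous relaxation and the regular part\<close>

text \<open>The bounds at \<open>u\<close> are the numbers that are at least the lower limit of \<open>q\<close> at \<open>u\<close>. Working with
  them avoids the value \<open>\<infinity>\<close> outside the domain of the relaxation, which is the largest
  lower semicontinuous function below \<open>q\<close>.\<close>

definition relaxation_bound :: "('a::chilbert \<rightharpoonup> real) \<Rightarrow> 'a \<Rightarrow> real \<Rightarrow> bool" where
  "relaxation_bound q u c \<longleftrightarrow> (\<forall>e>0. \<exists>w\<in>dom q. norm (w - u) < e \<and> the (q w) < c + e)"

definition relaxation :: "('a::chilbert \<rightharpoonup> real) \<Rightarrow> ('a \<rightharpoonup> real)" where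
  "relaxation q u =
     (if \<exists>c. relaxation_bound q u c then Some (Inf {c. relaxation_bound q u c}) else None)"

text \<open>Recovery sequences in the sense of Gamma-convergence.\<close>

definition recovery :: "('a::chilbert \<rightharpoonup> real) \<Rightarrow> (nat \<Rightarrow> 'a) \<Rightarrow> 'a \<Rightarrow> bool" where
  "recovery q w u \<longleftrightarrow> u \<in> dom (relaxation q) \<and> (\<forall>n. w n \<in> dom q) \<and> w \<longlonglongrightarrow> u \<and>
     (\<lambda>n. the (q (w n))) \<longlonglongrightarrow> the (relaxation q u)"

lemma dom_relaxation_iff: "u \<in> dom (relaxation q) \<longleftrightarrow> (\<exists>c. relaxation_bound q u c)"
  by (simp add: relaxation_def domIff)

lemma relaxation_boundE:
  assumes "relaxation_bound q u c" "e > 0"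
  obtains w where "w \<in> dom q" "norm (w - u) < e" "the (q w) < c + e"
  using assms unfolding relaxation_bound_def by metis

lemma relaxation_bound_nonneg:
  assumes q: "positive_form q" and c: "relaxation_bound q u c"
  shows "0 \<le> c"
proof (rule field_le_epsilon)
  fix e :: real assume "e > 0"
  then obtain w where "w \<in> dom q" "the (q w) < c + e" using relaxation_boundE[OF c] by metis
  then show "0 \<le> c + e" using positive_form_nonneg[OF q, of w] by linarith
qed

lemma relaxation_le:
  assumes q: "positive_form q" and c: "relaxation_bound q u c"
  shows "u \<in> dom (relaxation q)" and "the (relaxation q u) \<le> c"
proof -
  have ex: "\<exists>c. relaxation_bound q u c" using c by blast
  then show "u \<in> dom (relaxation q)" by (simp add: dom_relaxation_iff)
  have "bdd_below {c. relaxation_bound q u c}"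
    using relaxation_bound_nonneg[OF q] by (intro bdd_belowI[of _ 0]) blast
  then have "Inf {c. relaxation_bound q u c} \<le> c" using c by (intro cInf_lower) auto
  then show "the (relaxation q u) \<le> c" using ex by (simp add: relaxation_def)
qed

lemma relaxation_bound_self: "u \<in> dom q \<Longrightarrow> relaxation_bound q u (the (q u))"
  unfolding relaxation_bound_def by (intro allI impI bexI[of _ u]) auto

lemma dom_subset_relaxation: "dom q \<subseteq> dom (relaxation q)"
  using relaxation_bound_self dom_relaxation_iff by blast

lemma relaxation_le_form:
  "positive_form q \<Longrightarrow> u \<in> dom q \<Longrightarrow> the (relaxation q u) \<le> the (q u)"
  by (rule relaxation_le(2)[OF _ relaxation_bound_self])

text \<open>The infimum is attained, so there are points of \<open>dom q\<close> close to \<open>u\<close> with values close to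
  the relaxed value.\<close>

lemma relaxation_bound_relaxation:
  assumes q: "positive_form q" and u: "u \<in> dom (relaxation q)"
  shows "relaxation_bound q u (the (relaxation q u))"
  unfolding relaxation_bound_def
proof (intro allI impI)
  fix e :: real assume e: "e > 0"
  have "{c. relaxation_bound q u c} \<noteq> {}" using u by (auto simp: dom_relaxation_iff)
  moreover have "Inf {c. relaxation_bound q u c} < the (relaxation q u) + e / 2"
    using u e unfolding dom_relaxation_iff by (simp add: relaxation_def)
  ultimately have "\<exists>c\<in>{c. relaxation_bound q u c}. c < the (relaxation q u) + e / 2"
    by (rule cInf_lessD)
  then obtain c where c: "relaxation_bound q u c" "c < the (relaxation q u) + e / 2" by blast
  obtain w where "w \<in> dom q" "norm (w - u) < e / 2" "the (q w) < c + e / 2"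
    by (rule relaxation_boundE[OF c(1) half_gt_zero[OF e]])
  then show "\<exists>w\<in>dom q. norm (w - u) < e \<and> the (q w) < the (relaxation q u) + e"
    using c(2) e by (intro bexI[of _ w]) auto
qed

lemma relaxation_nonneg:
  "positive_form q \<Longrightarrow> u \<in> dom (relaxation q) \<Longrightarrow> 0 \<le> the (relaxation q u)"
  using relaxation_bound_nonneg relaxation_bound_relaxation by blast

text \<open>This is the lower semicontinuity of the relaxation: points close to \<open>u\<close> can be replaced
  by points of \<open>dom q\<close> with almost the same value.\<close>

lemma relaxation_bound_idem:
  assumes q: "positive_form q" and c: "relaxation_bound (relaxation q) u c"
  shows "relaxation_bound q u c"
  unfolding relaxation_bound_def
proof (intro allI impI)
  fix e :: real assume e: "e > 0"
  obtain x where x: "x \<in> dom (relaxation q)" "norm (x - u) < e / 2"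
      "the (relaxation q x) < c + e / 2"
    by (rule relaxation_boundE[OF c half_gt_zero[OF e]])
  obtain w where w: "w \<in> dom q" "norm (w - x) < e / 2" "the (q w) < the (relaxation q x) + e / 2"
    by (rule relaxation_boundE[OF relaxation_bound_relaxation[OF q x(1)] half_gt_zero[OF e]])
  have "norm (w - u) < e"
    using norm_triangle_ineq[of "w - x" "x - u"] w(2) x(2) by simp
  then show "\<exists>w\<in>dom q. norm (w - u) < e \<and> the (q w) < c + e"
    using w(1,3) x(3) by (intro bexI[of _ w]) auto
qed

lemma relaxation_bound_sequence:
  assumes w: "\<And>n. w n \<in> dom q" "w \<longlonglongrightarrow> u"
    and c: "\<And>e. e > 0 \<Longrightarrow> \<exists>\<^sub>F n in sequentially. the (q (w n)) < c + e"
  shows "relaxation_bound q u c"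
  unfolding relaxation_bound_def
proof (intro allI impI)
  fix e :: real assume e: "e > 0"
  have "\<forall>\<^sub>F n in sequentially. norm (w n - u) < e"
    using tendstoD[OF w(2) e] by (simp add: dist_norm)
  from frequently_ex[OF frequently_eventually_conj[OF c[OF e] this]]
  obtain n where "norm (w n - u) < e" "the (q (w n)) < c + e" by blast
  then show "\<exists>w\<in>dom q. norm (w - u) < e \<and> the (q w) < c + e" using w(1) by blast
qed

lemma relaxation_lsc:
  assumes q: "positive_form q" and w: "\<And>n. w n \<in> dom q" "w \<longlonglongrightarrow> u"
    and c: "c < the (relaxation q u)"
  shows "\<forall>\<^sub>F n in sequentially. c < the (q (w n))"
proof (rule ccontr)
  assume "\<not> ?thesis"
  then have le: "\<exists>\<^sub>F n in sequentially. the (q (w n)) \<le> c"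
    by (simp add: frequently_def not_le)
  have "relaxation_bound q u c"
    by (rule relaxation_bound_sequence[OF w]) (rule frequently_elim1[OF le], simp)
  from relaxation_le(2)[OF q this] c show False by simp
qed

lemma recoveryD:
  assumes "recovery q w u"
  shows "u \<in> dom (relaxation q)" "\<And>n. w n \<in> dom q" "w \<longlonglongrightarrow> u"
    "(\<lambda>n. the (q (w n))) \<longlonglongrightarrow> the (relaxation q u)"
  using assms by (simp_all add: recovery_def)

lemma recovery_exists:
  assumes q: "positive_form q" and u: "u \<in> dom (relaxation q)"
  obtains w where "recovery q w u"
proof -
  have "\<forall>n. \<exists>w\<in>dom q. norm (w - u) < 1 / Suc n \<and> the (q w) < the (relaxation q u) + 1 / Suc n"
    using relaxation_bound_relaxation[OF q u] unfolding relaxation_bound_def by simp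
  then obtain w where w: "\<And>n. w n \<in> dom q" "\<And>n. norm (w n - u) < 1 / Suc n"
    "\<And>n. the (q (w n)) < the (relaxation q u) + 1 / Suc n"
    by metis
  note inv = LIMSEQ_Suc[OF lim_inverse_n', unfolded inverse_eq_divide]
  have "(\<lambda>n. w n - u) \<longlonglongrightarrow> 0"
    by (rule Lim_null_comparison[OF always_eventually inv]) (use w(2) in \<open>simp add: less_imp_le\<close>)
  then have lim: "w \<longlonglongrightarrow> u" by (simp add: LIM_zero_iff)
  have "(\<lambda>n. the (q (w n))) \<longlonglongrightarrow> the (relaxation q u)"
  proof (rule order_tendstoI)
    show "\<forall>\<^sub>F n in sequentially. c < the (q (w n))" if "c < the (relaxation q u)" for c
      by (rule relaxation_lsc[OF q w(1) lim that])
    show "\<forall>\<^sub>F n in sequentially. the (q (w n)) < c" if "the (relaxation q u) < c" for c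
    proof -
      have "(\<lambda>n. the (relaxation q u) + 1 / real (Suc n)) \<longlonglongrightarrow> the (relaxation q u) + 0"
        by (intro tendsto_intros inv)
      then have "\<forall>\<^sub>F n in sequentially. the (relaxation q u) + 1 / real (Suc n) < c"
        using that by (intro order_tendstoD(2)) auto
      then show ?thesis by (rule eventually_mono) (use w(3) less_trans in blast)
    qed
  qed
  then show thesis using that u w(1) lim unfolding recovery_def by blast
qed

lemma relaxation_scaleC_le:
  assumes q: "positive_form q" and u: "u \<in> dom (relaxation q)"
  shows "a *\<^sub>C u \<in> dom (relaxation q)"
    and "the (relaxation q (a *\<^sub>C u)) \<le> (cmod a)\<^sup>2 * the (relaxation q u)"
proof -
  obtain w where w: "recovery q w u" using recovery_exists[OF q u] .
  have "(\<lambda>n. (cmod a)\<^sup>2 * the (q (w n))) \<longlonglongrightarrow> (cmod a)\<^sup>2 * the (relaxation q u)"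
    by (intro tendsto_intros recoveryD(4)[OF w])
  then have lim: "(\<lambda>n. the (q (a *\<^sub>C w n))) \<longlonglongrightarrow> (cmod a)\<^sup>2 * the (relaxation q u)"
    by (simp add: form_scaleC[OF q recoveryD(2)[OF w]])
  have "relaxation_bound q (a *\<^sub>C u) ((cmod a)\<^sup>2 * the (relaxation q u))"
  proof (rule relaxation_bound_sequence)
    show "a *\<^sub>C w n \<in> dom q" for n using q recoveryD(2)[OF w] by (simp add: form_closed)
    show "(\<lambda>n. a *\<^sub>C w n) \<longlonglongrightarrow> a *\<^sub>C u" by (rule tendsto_scaleC[OF recoveryD(3)[OF w]])
    show "\<exists>\<^sub>F n in sequentially. the (q (a *\<^sub>C w n)) < (cmod a)\<^sup>2 * the (relaxation q u) + e"
      if "e > 0" for e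
      using order_tendstoD(2)[OF lim, of "(cmod a)\<^sup>2 * the (relaxation q u) + e"] that
      by (intro eventually_frequently) auto
  qed
  from relaxation_le[OF q this] show "a *\<^sub>C u \<in> dom (relaxation q)"
    and "the (relaxation q (a *\<^sub>C u)) \<le> (cmod a)\<^sup>2 * the (relaxation q u)" .
qed

text \<open>The inequality for the factor \<open>1/a\<close> gives the reverse inequality for \<open>a\<close>.\<close>

lemma relaxation_scaleC:
  assumes q: "positive_form q" and u: "u \<in> dom (relaxation q)"
  shows "the (relaxation q (a *\<^sub>C u)) = (cmod a)\<^sup>2 * the (relaxation q u)"
proof (cases "a = 0")
  case True
  then show ?thesis
    using relaxation_scaleC_le[OF q u, of a] relaxation_nonneg[OF q, of "a *\<^sub>C u"] by simp
next
  case False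
  note le = relaxation_scaleC_le[OF q u, of a]
  have "inverse a *\<^sub>C (a *\<^sub>C u) = u"
    using False scaleR_scaleC[of 1 u] by (simp add: scaleC_scaleC)
  then have "the (relaxation q u) \<le> (cmod (inverse a))\<^sup>2 * the (relaxation q (a *\<^sub>C u))"
    using relaxation_scaleC_le(2)[OF q le(1), of "inverse a"] by simp
  then have "(cmod a)\<^sup>2 * the (relaxation q u) \<le> the (relaxation q (a *\<^sub>C u))"
    using False by (simp add: norm_inverse power_inverse) (simp add: field_simps)
  then show ?thesis using le(2) by simp
qed

text \<open>Sums and differences of recovery sequences are admissible competitors at \<open>u + u'\<close> and
  \<open>u - u'\<close>, which gives one half of the parallelogram law.\<close>

lemma relaxation_add_le:
  assumes q: "positive_form q" and w: "recovery q w u" and w': "recovery q w' u'"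
  shows "u + u' \<in> dom (relaxation q)" and "u - u' \<in> dom (relaxation q)"
    and "the (relaxation q (u + u')) + the (relaxation q (u - u'))
      \<le> 2 * the (relaxation q u) + 2 * the (relaxation q u')"
proof -
  let ?C = "\<lambda>u. the (relaxation q u)"
  define L where "L = 2 * ?C u + 2 * ?C u'"
  have dom: "w n + w' n \<in> dom q" "w n - w' n \<in> dom q" for n
    using q recoveryD(2)[OF w] recoveryD(2)[OF w'] by (simp_all add: form_closed)
  note par = form_parallelogram[OF q recoveryD(2)[OF w] recoveryD(2)[OF w']]
  have "(\<lambda>n. 2 * the (q (w n)) + 2 * the (q (w' n))) \<longlonglongrightarrow> L"
    unfolding L_def by (intro tendsto_intros recoveryD(4) w w')
  then have sum: "(\<lambda>n. the (q (w n + w' n)) + the (q (w n - w' n))) \<longlonglongrightarrow> L" by (simp add: par)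
  have less: "\<forall>\<^sub>F n in sequentially. the (q (w n + w' n)) + the (q (w n - w' n)) < L + e"
    if "e > 0" for e
    using order_tendstoD(2)[OF sum, of "L + e"] that by simp
  have lim: "(\<lambda>n. w n + w' n) \<longlonglongrightarrow> u + u'" "(\<lambda>n. w n - w' n) \<longlonglongrightarrow> u - u'"
    using tendsto_add tendsto_diff recoveryD(3)[OF w] recoveryD(3)[OF w'] by blast+
  have freq: "\<exists>\<^sub>F n in sequentially. the (q (w n + w' n)) < L + e"
      "\<exists>\<^sub>F n in sequentially. the (q (w n - w' n)) < L + e" if "e > 0" for e
  proof -
    have "the (q (w n + w' n)) < L + e \<and> the (q (w n - w' n)) < L + e"
      if "the (q (w n + w' n)) + the (q (w n - w' n)) < L + e" for n
      using that positive_form_nonneg[OF q dom(1)[of n]] positive_form_nonneg[OF q dom(2)[of n]]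
      by linarith
    with less[OF that] have "\<forall>\<^sub>F n in sequentially.
        the (q (w n + w' n)) < L + e \<and> the (q (w n - w' n)) < L + e"
      by (auto elim: eventually_mono)
    then show "\<exists>\<^sub>F n in sequentially. the (q (w n + w' n)) < L + e"
      "\<exists>\<^sub>F n in sequentially. the (q (w n - w' n)) < L + e"
      by (auto intro!: eventually_frequently elim: eventually_mono)
  qed
  show "u + u' \<in> dom (relaxation q)"
    by (rule relaxation_le(1)[OF q relaxation_bound_sequence[OF dom(1) lim(1) freq(1)]])
  show "u - u' \<in> dom (relaxation q)"
    by (rule relaxation_le(1)[OF q relaxation_bound_sequence[OF dom(2) lim(2) freq(2)]])
  show "?C (u + u') + ?C (u - u') \<le> 2 * ?C u + 2 * ?C u'"
  proof (rule ccontr)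
    define e where "e = (?C (u + u') + ?C (u - u') - L) / 3"
    assume "\<not> ?thesis"
    then have e: "e > 0" by (simp add: e_def L_def)
    have "\<forall>\<^sub>F n in sequentially. ?C (u + u') - e < the (q (w n + w' n))"
      "\<forall>\<^sub>F n in sequentially. ?C (u - u') - e < the (q (w n - w' n))"
      using relaxation_lsc[OF q dom(1) lim(1)] relaxation_lsc[OF q dom(2) lim(2)] e by auto
    with less[OF e] have "\<forall>\<^sub>F n in sequentially. False"
      by eventually_elim (simp add: e_def field_simps)
    then show False by simp
  qed
qed

text \<open>The inequality applied to \<open>u + v\<close> and \<open>u - v\<close>, together with \<open>C[2u] = 4 C[u]\<close>, is the reverse
  inequality.\<close>

lemma relaxation_parallelogram:
  assumes q: "positive_form q" and u: "u \<in> dom (relaxation q)" and v: "v \<in> dom (relaxation q)"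
  shows "the (relaxation q (u + v)) + the (relaxation q (u - v))
      = 2 * the (relaxation q u) + 2 * the (relaxation q v)"
proof -
  let ?C = "\<lambda>u. the (relaxation q u)"
  have le: "u + v \<in> dom (relaxation q) \<and> u - v \<in> dom (relaxation q) \<and>
      ?C (u + v) + ?C (u - v) \<le> 2 * ?C u + 2 * ?C v"
    if uv: "u \<in> dom (relaxation q)" "v \<in> dom (relaxation q)" for u v
  proof -
    obtain w w' where "recovery q w u" "recovery q w' v"
      using recovery_exists[OF q uv(1)] recovery_exists[OF q uv(2)] by metis
    then show ?thesis using relaxation_add_le[OF q] by blast
  qed
  have two: "x + x = complex_of_real 2 *\<^sub>C x" for x :: 'a
    by (simp only: scaleR_2[symmetric] scaleR_scaleC)
  have "?C (u + u) = 4 * ?C u" "?C (v + v) = 4 * ?C v"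
    unfolding two using relaxation_scaleC[OF q] u v by simp_all
  then show ?thesis
    using le[OF u v] le[of "u + v" "u - v"] by simp
qed

text \<open>Neither \<open>q[w\<^sub>n + w'\<^sub>n]\<close> nor \<open>q[w\<^sub>n - w'\<^sub>n]\<close> can asymptotically fall below the relaxed value,
  and by the two parallelogram laws their sum converges to the sum of the relaxed values; so both
  converge. This stability makes the relaxation a limit of values of \<open>q\<close>, hence a quadratic
  form.\<close>

lemma recovery_add:
  assumes q: "positive_form q" and w: "recovery q w u" and w': "recovery q w' u'"
  shows "recovery q (\<lambda>n. w n + w' n) (u + u')"
proof -
  let ?C = "\<lambda>u. the (relaxation q u)"
  have dom: "w n + w' n \<in> dom q" "w n - w' n \<in> dom q" for n
    using q recoveryD(2)[OF w] recoveryD(2)[OF w'] by (simp_all add: form_closed)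
  have lim: "(\<lambda>n. w n + w' n) \<longlonglongrightarrow> u + u'" "(\<lambda>n. w n - w' n) \<longlonglongrightarrow> u - u'"
    using tendsto_add tendsto_diff recoveryD(3)[OF w] recoveryD(3)[OF w'] by blast+
  note par = form_parallelogram[OF q recoveryD(2)[OF w] recoveryD(2)[OF w']]
  have sum: "(\<lambda>n. 2 * the (q (w n)) + 2 * the (q (w' n))) \<longlonglongrightarrow> 2 * ?C u + 2 * ?C u'"
    by (intro tendsto_intros recoveryD(4) w w')
  have "(\<lambda>n. the (q (w n + w' n))) \<longlonglongrightarrow> ?C (u + u')"
  proof (rule order_tendstoI)
    show "\<forall>\<^sub>F n in sequentially. c < the (q (w n + w' n))" if "c < ?C (u + u')" for c
      by (rule relaxation_lsc[OF q dom(1) lim(1) that])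
    show "\<forall>\<^sub>F n in sequentially. the (q (w n + w' n)) < c" if "?C (u + u') < c" for c
    proof -
      define e where "e = (c - ?C (u + u')) / 2"
      have e: "e > 0" using that by (simp add: e_def)
      have "\<forall>\<^sub>F n in sequentially. ?C (u - u') - e < the (q (w n - w' n))"
        using relaxation_lsc[OF q dom(2) lim(2)] e by auto
      moreover have "\<forall>\<^sub>F n in sequentially. 2 * the (q (w n)) + 2 * the (q (w' n))
          < 2 * ?C u + 2 * ?C u' + e"
        using order_tendstoD(2)[OF sum] e by simp
      ultimately show ?thesis
      proof eventually_elim
        case (elim n)
        then show ?case
          using par[of n n] relaxation_parallelogram[OF q recoveryD(1)[OF w] recoveryD(1)[OF w']]
          unfolding e_def by argo
      qed
    qed
  qed
  then show ?thesis
    unfolding recovery_def using relaxation_add_le(1)[OF q w w'] dom(1) lim(1) by blast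
qed

lemma recovery_scaleC:
  assumes q: "positive_form q" and w: "recovery q w u"
  shows "recovery q (\<lambda>n. a *\<^sub>C w n) (a *\<^sub>C u)"
  unfolding recovery_def form_scaleC[OF q recoveryD(2)[OF w]]
    relaxation_scaleC[OF q recoveryD(1)[OF w]]
proof (intro conjI allI)
  show "a *\<^sub>C u \<in> dom (relaxation q)" by (rule relaxation_scaleC_le(1)[OF q recoveryD(1)[OF w]])
  show "a *\<^sub>C w n \<in> dom q" for n using q recoveryD(2)[OF w] by (simp add: form_closed)
  show "(\<lambda>n. a *\<^sub>C w n) \<longlonglongrightarrow> a *\<^sub>C u" by (rule tendsto_scaleC[OF recoveryD(3)[OF w]])
  show "(\<lambda>n. (cmod a)\<^sup>2 * the (q (w n))) \<longlonglongrightarrow> (cmod a)\<^sup>2 * the (relaxation q u)"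
    by (intro tendsto_intros recoveryD(4)[OF w])
qed

lemma positive_form_relaxation:
  assumes q: "positive_form q"
  shows "positive_form (relaxation q)"
proof (rule positive_form_limit[where Q = "\<lambda>_. q" and approx = "recovery q"])
  show "csubspace (dom (relaxation q))"
    unfolding csubspace_def
  proof (intro conjI ballI allI)
    show "0 \<in> dom (relaxation q)" using form_closed(5)[OF q] dom_subset_relaxation by blast
    show "x + y \<in> dom (relaxation q)" if xy: "x \<in> dom (relaxation q)" "y \<in> dom (relaxation q)" for x y
    proof -
      obtain w w' where "recovery q w x" "recovery q w' y"
        using recovery_exists[OF q xy(1)] recovery_exists[OF q xy(2)] by metis
      then show ?thesis by (rule relaxation_add_le(1)[OF q])
    qed
    show "a *\<^sub>C x \<in> dom (relaxation q)" if "x \<in> dom (relaxation q)" for a x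
      by (rule relaxation_scaleC_le(1)[OF q that])
  qed
  show "\<exists>w. recovery q w u" if u: "u \<in> dom (relaxation q)" for u
    using recovery_exists[OF q u] by metis
qed (use q in \<open>simp_all add: recoveryD(2,4) recovery_add recovery_scaleC del: domIff\<close>)

text \<open>If \<open>C[X\<^sub>m - X\<^sub>n] < e\<close> for large \<open>m, n\<close>, letting \<open>n \<rightarrow> \<infinity>\<close> gives \<open>C[X\<^sub>m - u] \<le> e\<close> by lower
  semicontinuity.\<close>

lemma closed_form_relaxation:
  assumes q: "positive_form q"
  shows "closed_form (relaxation q)"
  unfolding closed_form_def
proof (intro conjI allI impI positive_form_relaxation[OF q])
  let ?C = "relaxation q"
  note C = positive_form_relaxation[OF q]
  fix X u
  assume *: "(\<forall>n. X n \<in> dom ?C) \<and> X \<longlonglongrightarrow> u \<and>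
    (\<forall>e>0. \<exists>N. \<forall>m\<ge>N. \<forall>n\<ge>N. the (?C (X m - X n)) < e)"
  then have X: "\<And>n. X n \<in> dom ?C" "X \<longlonglongrightarrow> u" by auto
  have key: "\<exists>N. \<forall>m\<ge>N. X m - u \<in> dom ?C \<and> the (?C (X m - u)) \<le> e" if e: "e > 0" for e
  proof -
    obtain N where N: "\<And>m n. m \<ge> N \<Longrightarrow> n \<ge> N \<Longrightarrow> the (?C (X m - X n)) < e" using * e by blast
    have "X m - u \<in> dom ?C \<and> the (?C (X m - u)) \<le> e" if m: "m \<ge> N" for m
    proof -
      have "relaxation_bound ?C (X m - u) e"
      proof (rule relaxation_bound_sequence)
        show "X m - X n \<in> dom ?C" for n using C X(1) by (simp add: form_closed)
        show "(\<lambda>n. X m - X n) \<longlonglongrightarrow> X m - u" by (intro tendsto_intros X(2))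
        show "\<exists>\<^sub>F n in sequentially. the (?C (X m - X n)) < e + d" if "d > 0" for d
        proof (intro eventually_frequently eventually_sequentiallyI[of N])
          show "the (?C (X m - X n)) < e + d" if "n \<ge> N" for n
            using N[OF m that] \<open>d > 0\<close> by linarith
        qed simp
      qed
      from relaxation_le[OF q relaxation_bound_idem[OF q this]] show ?thesis ..
    qed
    then show ?thesis by blast
  qed
  obtain N where "X N - u \<in> dom ?C" using key[OF zero_less_one] by blast
  from form_closed(2)[OF C X(1)[of N] this] show u: "u \<in> dom ?C" by simp
  show "(\<lambda>n. the (?C (X n - u))) \<longlonglongrightarrow> 0"
  proof (rule LIMSEQ_I)
    fix r :: real assume "r > 0"
    then obtain N where N: "\<And>m. m \<ge> N \<Longrightarrow> X m - u \<in> dom ?C \<and> the (?C (X m - u)) \<le> r / 2"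
      using key[of "r / 2"] by auto
    have "norm (the (?C (X m - u)) - 0) < r" if "m \<ge> N" for m
      using N[OF that] positive_form_nonneg[OF C, of "X m - u"] \<open>r > 0\<close> by auto
    then show "\<exists>N. \<forall>m\<ge>N. norm (the (?C (X m - u)) - 0) < r" by blast
  qed
qed

text \<open>Along a recovery sequence the parallelogram law turns convergence of the values into
  convergence in the form norm: \<open>C[w\<^sub>n - u] = 2 C[w\<^sub>n] + 2 C[u] - C[w\<^sub>n + u]\<close>, and the last
  term is at least \<open>C[2u] = 4 C[u]\<close> in the limit. So \<open>dom q\<close> is a core of \<open>C\<close>.\<close>

lemma recovery_form_convergence:
  assumes q: "positive_form q" and w: "recovery q w u"
  shows "(\<lambda>n. the (relaxation q (w n - u))) \<longlonglongrightarrow> 0"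
proof -
  let ?C = "\<lambda>u. the (relaxation q u)"
  note C = positive_form_relaxation[OF q]
  note u = recoveryD(1)[OF w]
  have wC: "w n \<in> dom (relaxation q)" for n
    using recoveryD(2)[OF w] dom_subset_relaxation by blast
  have dom: "w n + u \<in> dom (relaxation q)" "w n - u \<in> dom (relaxation q)" for n
    using C wC u by (simp_all add: form_closed)
  show ?thesis
  proof (rule order_tendstoI)
    show "\<forall>\<^sub>F n in sequentially. c < ?C (w n - u)" if "c < 0" for c
      using that positive_form_nonneg[OF C dom(2)] by (intro always_eventually allI) (rule less_le_trans)
    show "\<forall>\<^sub>F n in sequentially. ?C (w n - u) < c" if c: "0 < c" for c
    proof -
      have four: "?C (u + u) = 4 * ?C u"
        using form_scaleR[OF C u, of 2] by (simp add: scaleR_2)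
      have "\<forall>\<^sub>F n in sequentially. 4 * ?C u - c / 2 < ?C (w n + u)"
      proof (rule relaxation_lsc[OF C dom(1)])
        show "(\<lambda>n. w n + u) \<longlonglongrightarrow> u + u" by (intro tendsto_intros recoveryD(3)[OF w])
        have uu: "u + u \<in> dom (relaxation q)" using C u by (simp add: form_closed)
        have "u + u \<in> dom (relaxation (relaxation q))" using uu dom_subset_relaxation by blast
        \<comment> \<open>relaxing twice does not lower the values\<close>
        from relaxation_bound_idem[OF q relaxation_bound_relaxation[OF C this]]
        have "?C (u + u) \<le> the (relaxation (relaxation q) (u + u))" by (rule relaxation_le(2)[OF q])
        then show "4 * ?C u - c / 2 < the (relaxation (relaxation q) (u + u))"
          using four c by linarith
      qed
      moreover have "\<forall>\<^sub>F n in sequentially. the (q (w n)) < ?C u + c / 4"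
        using order_tendstoD(2)[OF recoveryD(4)[OF w]] c by simp
      ultimately show ?thesis
      proof eventually_elim
        case (elim n)
        then show ?case
          using form_parallelogram[OF C wC u, of n] relaxation_le_form[OF q recoveryD(2)[OF w], of n]
          by argo
      qed
    qed
  qed
qed

lemma positive_form_restrict:
  assumes C: "positive_form C" and S: "csubspace S" "S \<subseteq> dom C"
  shows "positive_form (C |` S)"
proof -
  have d: "dom (C |` S) = S" using S by auto
  obtain s where s: "sesquilinear_on (dom C) s" "\<forall>u\<in>dom C. s u u = complex_of_real (the (C u))"
    using C unfolding positive_form_def by blast
  have "sesquilinear_on S s" using s(1) S(2) unfolding sesquilinear_on_def by (meson subset_iff)
  then show ?thesis
    using s(2) S positive_form_nonneg[OF C] unfolding positive_form_def d
    by (intro conjI exI[of _ s]) (auto simp: subset_iff)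
qed

text \<open>Maximality: a closable minorant has a closed, hence lower semicontinuous, extension, which
  lies below the lower limits of \<open>q\<close> on \<open>dom q\<close>. Closure: \<open>dom q\<close> is a core, so a recovery
  sequence is Cauchy for every closed extension \<open>C'\<close> of the restriction, and the values at \<open>u\<close> agree in the limit.\<close>

theorem relaxation_regular_part:
  assumes q: "positive_form q" and D: "densely_defined q"
  shows "is_regular_part q (relaxation q |` dom q)"
    and "is_form_closure (relaxation q |` dom q) (relaxation q)"
proof -
  let ?C = "relaxation q" and ?R = "relaxation q |` dom q"
  note C = positive_form_relaxation[OF q] and Cc = closed_form_relaxation[OF q]
  have domR: "dom ?R = dom q" using dom_subset_relaxation by auto
  have R_eq: "?R u = ?C u" if "u \<in> dom q" for u using that by simp
  have R: "positive_form ?R"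
    by (rule positive_form_restrict[OF C positive_form_subspace[OF q] dom_subset_relaxation])
  have RC: "?R \<subseteq>\<^sub>m ?C" by (auto simp: map_le_def)
  have "closable_minorant q ?R"
    unfolding closable_minorant_def closable_form_def densely_defined_def domR
    using R Cc RC D relaxation_le_form[OF q] unfolding densely_defined_def by auto
  moreover have "the (R' u) \<le> the (?R u)" if R': "closable_minorant q R'" and u: "u \<in> dom q" for R' u
  proof -
    obtain C' where C': "closed_form C'" "R' \<subseteq>\<^sub>m C'" and domR': "dom R' = dom q"
      and le: "\<And>w. w \<in> dom q \<Longrightarrow> the (R' w) \<le> the (q w)"
      using R' unfolding closable_minorant_def closable_form_def by blast
    have eq: "C' w = R' w" "w \<in> dom C'" if "w \<in> dom q" for w
    proof -
      show "C' w = R' w" using C'(2) that domR' unfolding map_le_def by force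
      then show "w \<in> dom C'" using that domR' by (metis domIff)
    qed
    have "the (C' u) \<le> the (?C u)"
    proof (rule closed_form_lsc(2)[OF C'(1)])
      fix e :: real assume "e > 0"
      then obtain w where "w \<in> dom q" "norm (w - u) < e" "the (q w) < the (?C u) + e"
        using relaxation_bound_relaxation[OF q, of u] u dom_subset_relaxation
        unfolding relaxation_bound_def by blast
      then show "\<exists>w\<in>dom C'. norm (w - u) < e \<and> the (C' w) < the (?C u) + e"
        using le[of w] eq[of w] by (intro bexI[of _ w]) auto
    qed
    then show ?thesis using eq(1)[OF u] R_eq[OF u] by simp
  qed
  ultimately show "is_regular_part q ?R" unfolding is_regular_part_def using q D by blast
  have "?C \<subseteq>\<^sub>m C'" if C': "closed_form C'" "?R \<subseteq>\<^sub>m C'" for C'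
    unfolding map_le_def
  proof
    fix u assume u: "u \<in> dom ?C"
    obtain w where w: "recovery q w u" using recovery_exists[OF q u] .
    have eq: "C' v = ?C v" "v \<in> dom C'" if "v \<in> dom q" for v
    proof -
      have "?R v = C' v" using C'(2) that domR unfolding map_le_def by blast
      then show "C' v = ?C v" using that by simp
      then show "v \<in> dom C'" using that dom_subset_relaxation[of q] by (auto simp: domIff subset_iff)
    qed
    note wq = recoveryD(2)[OF w]
    have wC: "w n \<in> dom ?C" for n using wq dom_subset_relaxation by blast
    note conv = recovery_form_convergence[OF q w]
    have "\<exists>N. \<forall>m\<ge>N. \<forall>n\<ge>N. the (C' (w m - w n)) < e" if e: "e > 0" for e
    proof -
      obtain N where N: "\<And>n. n \<ge> N \<Longrightarrow> the (?C (w n - u)) < e / 4"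
        using order_tendstoD(2)[OF conv, of "e / 4"] e by (auto simp: eventually_sequentially)
      have "the (C' (w m - w n)) < e" if "m \<ge> N" "n \<ge> N" for m n
      proof -
        have d: "w m - u \<in> dom ?C" "w n - u \<in> dom ?C" using C wC u by (simp_all add: form_closed)
        have "w m - w n \<in> dom q" using q wq by (simp add: form_closed)
        then have "the (C' (w m - w n)) = the (?C ((w m - u) - (w n - u)))" by (simp add: eq)
        also have "\<dots> \<le> 2 * the (?C (w m - u)) + 2 * the (?C (w n - u))"
          using form_parallelogram[OF C d] positive_form_nonneg[OF C form_closed(1)[OF C d]]
          by linarith
        finally show ?thesis using N[OF that(1)] N[OF that(2)] by linarith
      qed
      then show ?thesis by blast
    qed
    then have u': "u \<in> dom C'" and lim: "(\<lambda>n. the (C' (w n - u))) \<longlonglongrightarrow> 0"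
      using C'(1) eq(2)[OF wq] recoveryD(3)[OF w] unfolding closed_form_def by blast+
    have "(\<lambda>n. the (C' (w n))) \<longlonglongrightarrow> the (C' u)"
      by (rule form_tendsto[OF closed_form_positive[OF C'(1)] eq(2)[OF wq] u' lim])
    moreover have "(\<lambda>n. the (C' (w n))) \<longlonglongrightarrow> the (?C u)"
      using form_tendsto[OF C wC u conv] by (simp add: eq(1)[OF wq])
    ultimately have "the (C' u) = the (?C u)" by (rule LIMSEQ_unique)
    then show "?C u = C' u" using u u' by (metis domD option.sel)
  qed
  then show "is_form_closure ?R ?C" unfolding is_form_closure_def using R Cc RC by blast
qed

lemma closable_form_eq_regular_part:
  assumes q: "closable_form q" and D: "densely_defined q"
  shows "relaxation q |` dom q = q"
proof -
  have qp: "positive_form q" using q by (simp add: closable_form_def)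
  have "closable_minorant q q" using q D by (simp add: closable_minorant_def)
  have ge: "the (q u) \<le> the (relaxation q u)" if "u \<in> dom q" for u
  proof -
    have "the (q u) \<le> the ((relaxation q |` dom q) u)"
      using \<open>closable_minorant q q\<close> relaxation_regular_part(1)[OF qp D] that
      unfolding is_regular_part_def by blast
    then show ?thesis unfolding restrict_in[OF that] .
  qed
  show ?thesis
  proof
    fix u
    show "(relaxation q |` dom q) u = q u"
    proof (cases "u \<in> dom q")
      case True
      then have "the (relaxation q u) = the (q u)"
        using ge[of u] relaxation_le_form[OF qp, of u] by linarith
      moreover have "u \<in> dom (relaxation q)" using True dom_subset_relaxation by blast
      ultimately have "relaxation q u = q u" using True by (metis domD option.sel)
      then show ?thesis using True by simp
    qed (simp add: restrict_map_def domIff)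
  qed
qed

section \<open>Resolvents of a decreasing family of forms\<close>

text \<open>Put \<open>m = min (C[w] + \<parallel>w - f\<parallel>\<^sup>2)\<close>, where \<open>C\<close> is the relaxation. A point of a recovery
  sequence for the minimizer of \<open>C\<close> is a competitor for \<open>Q\<^sub>l\<close> whose value is eventually close to \<open>m\<close>. As
  \<open>C \<le> q \<le> Q\<^sub>l\<close>, the minimizers for \<open>Q\<^sub>l\<close> form a minimizing family for \<open>C\<close>, which converges by
  uniform convexity.\<close>

theorem minimizer_tendsto_relaxation:
  assumes q: "positive_form q"
    and Q: "\<forall>\<^sub>F l in F. closed_form (Q l) \<and> dom (Q l) = dom q \<and> (\<forall>u\<in>dom q. the (q u) \<le> the (Q l u))"
    and lim: "\<And>u. u \<in> dom q \<Longrightarrow> ((\<lambda>l. the (Q l u)) \<longlongrightarrow> the (q u)) F"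
  shows "((\<lambda>l. minimizer (Q l) 1 f) \<longlongrightarrow> minimizer (relaxation q) 1 f) F"
proof (rule tendstoI)
  fix e :: real assume e: "e > 0"
  let ?C = "relaxation q"
  let ?u = "minimizer ?C 1 f"
  define m where "m = penalized ?C 1 f ?u"
  note C = closed_form_relaxation[OF q]
  note Cp = closed_form_positive[OF C]
  have uC: "?u \<in> dom ?C" by (rule minimizer(1)[OF C zero_less_one])
  have min: "m \<le> penalized ?C 1 f w" if "w \<in> dom ?C" for w
    unfolding m_def by (rule minimizer(2)[OF C zero_less_one that])
  obtain w where w: "recovery q w ?u" using recovery_exists[OF q uC] .
  have "(\<lambda>n. penalized q 1 f (w n)) \<longlonglongrightarrow> m"
    unfolding m_def penalized_def by (intro tendsto_intros recoveryD(3,4)[OF w])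
  then have "\<forall>\<^sub>F n in sequentially. penalized q 1 f (w n) < m + e\<^sup>2 / 2"
    using e by (intro order_tendstoD(2)) auto
  then obtain n where n: "penalized q 1 f (w n) < m + e\<^sup>2 / 2"
    using eventually_happens by fastforce
  have wn: "w n \<in> dom q" by (rule recoveryD(2)[OF w])
  have "((\<lambda>l. penalized (Q l) 1 f (w n)) \<longlongrightarrow> penalized q 1 f (w n)) F"
    unfolding penalized_def by (intro tendsto_intros lim[OF wn])
  from order_tendstoD(2)[OF this n]
  have "\<forall>\<^sub>F l in F. penalized (Q l) 1 f (w n) < m + e\<^sup>2 / 2" .
  with Q show "\<forall>\<^sub>F l in F. dist (minimizer (Q l) 1 f) ?u < e"
  proof eventually_elim
    case (elim l)
    let ?p = "minimizer (Q l) 1 f"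
    have Ql: "closed_form (Q l)" "dom (Q l) = dom q" using elim(1) by auto
    have p: "?p \<in> dom q" using minimizer(1)[OF Ql(1) zero_less_one] Ql(2) by simp
    have pC: "?p \<in> dom ?C" using p dom_subset_relaxation by blast
    have "penalized ?C 1 f ?p \<le> penalized q 1 f ?p"
      unfolding penalized_def using relaxation_le_form[OF q p] by simp
    also have "\<dots> \<le> penalized (Q l) 1 f ?p"
      unfolding penalized_def using elim(1) p by (intro add_right_mono) blast
    also have "\<dots> \<le> penalized (Q l) 1 f (w n)"
      using minimizer(2)[OF Ql(1) zero_less_one] wn Ql(2) by simp
    also have "\<dots> < m + e\<^sup>2 / 2" by (rule elim(2))
    finally have p_less: "penalized ?C 1 f ?p < m + e\<^sup>2 / 2" .
    have mid: "(1/2) *\<^sub>R (?p + ?u) \<in> dom ?C" using Cp pC uC by (simp add: form_closed)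
    have "0 \<le> the (?C (?p - ?u))"
      using Cp pC uC by (intro positive_form_nonneg) (simp_all add: form_closed)
    then have "(norm (?p - ?u))\<^sup>2 < e\<^sup>2"
      using penalized_midpoint[OF Cp pC uC, of 1 f] min[OF mid] p_less m_def by argo
    then show ?case using e by (simp add: dist_norm power_less_imp_less_base)
  qed
qed

section \<open>Traces of forms\<close>

lemma dom_shifted_form [simp]: "dom (shifted_form E l) = dom E"
  by (auto simp: shifted_form_def)

lemma shifted_form_value: "u \<in> dom E \<Longrightarrow> the (shifted_form E l u) = penalized E l 0 u"
  by (auto simp: shifted_form_def penalized_def)

lemma
  assumes E: "positive_form E" and l: "l \<ge> 0"
  shows positive_form_shifted: "positive_form (shifted_form E l)"
    and sesq_shifted: "u \<in> dom E \<Longrightarrow> v \<in> dom E \<Longrightarrow>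
      sesq (shifted_form E l) u v = sesq E u v + l * cinner u v"
proof -
  define s where "s u v = sesq E u v + l * cinner u v" for u v
  have d: "csubspace (dom (shifted_form E l))" using positive_form_subspace[OF E] by simp
  have s: "sesquilinear_on (dom (shifted_form E l)) s"
    using positive_form_sesq(1)[OF E] unfolding sesquilinear_on_def dom_shifted_form s_def
    by (simp add: cinner_add_left cinner_add_right cinner_scaleC_left cinner_scaleC_right
        algebra_simps)
  have su: "s u u = complex_of_real (the (shifted_form E l u))"
    if "u \<in> dom (shifted_form E l)" for u
    using that positive_form_sesq(2)[OF E, of u]
    by (simp add: shifted_form_value penalized_def s_def cinner_self del: domIff)
  have "0 \<le> the (shifted_form E l u)" if "u \<in> dom E" for u
    using that l positive_form_nonneg[OF E that] by (simp add: shifted_form_value penalized_def del: domIff)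
  then show "positive_form (shifted_form E l)"
    unfolding positive_form_def using d s su by auto
  show "sesq (shifted_form E l) u v = sesq E u v + l * cinner u v" if "u \<in> dom E" "v \<in> dom E"
    using sesq_unique[OF d s su] that by (simp add: s_def)
qed

lemma
  assumes "linear_operator T"
  shows linear_operator_subspace: "csubspace (dom T)"
    and linear_operator_add: "T x = Some y \<Longrightarrow> T x' = Some y' \<Longrightarrow> T (x + x') = Some (y + y')"
    and linear_operator_scaleC: "T x = Some y \<Longrightarrow> T (a *\<^sub>C x) = Some (a *\<^sub>C y)"
proof -
  show "csubspace (dom T)" using assms by (simp add: linear_operator_def)
  show "T x = Some y \<Longrightarrow> T x' = Some y' \<Longrightarrow> T (x + x') = Some (y + y')"
    using assms unfolding linear_operator_def by (metis domI option.sel)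
  show "T x = Some y \<Longrightarrow> T (a *\<^sub>C x) = Some (a *\<^sub>C y)"
    using assms unfolding linear_operator_def by (metis domI option.sel)
qed

lemma linear_operator_diff:
  assumes T: "linear_operator T" and "T x = Some y" "T x' = Some y'"
  shows "T (x - x') = Some (y - y')"
  using linear_operator_add[OF T assms(2) linear_operator_scaleC[OF T assms(3), of "- 1"]]
  by (simp add: scaleC_minus_one)

lemma csubspace_ran:
  assumes T: "linear_operator T"
  shows "csubspace (ran T)"
proof -
  have "T 0 = Some (0 *\<^sub>C the (T 0))"
    using linear_operator_scaleC[OF T, of 0 _ 0] csubspace_zero[OF linear_operator_subspace[OF T]]
    by auto
  then have "0 \<in> ran T"
    using linear_operator_diff[OF T] by (metis cancel_comm_monoid_add_class.diff_cancel ranI)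
  moreover have "x + y \<in> ran T" if xy: "x \<in> ran T" "y \<in> ran T" for x y
  proof -
    obtain u w where "T u = Some x" "T w = Some y" using xy unfolding ran_def by blast
    then show ?thesis by (metis linear_operator_add[OF T] ranI)
  qed
  moreover have "a *\<^sub>C x \<in> ran T" if x: "x \<in> ran T" for a x
  proof -
    obtain u where "T u = Some x" using x unfolding ran_def by blast
    then show ?thesis by (metis linear_operator_scaleC[OF T] ranI)
  qed
  ultimately show ?thesis by (simp add: csubspace_def)
qed

lemma op_kernel_subspace:
  assumes T: "linear_operator T"
  shows "csubspace (op_kernel T)" "op_kernel T \<subseteq> dom T"
proof -
  obtain y where "T 0 = Some y" using csubspace_zero[OF linear_operator_subspace[OF T]] by blast
  then have "T 0 = Some 0" using linear_operator_diff[OF T] by fastforce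
  then show "csubspace (op_kernel T)"
    unfolding csubspace_def op_kernel_def
    using linear_operator_add[OF T] linear_operator_scaleC[OF T] by fastforce
  show "op_kernel T \<subseteq> dom T" by (auto simp: op_kernel_def)
qed

text \<open>The lift of \<open>v \<in> ran J\<close> is the element \<open>P\<^sub>\<lambda> u\<close>, for any \<open>u\<close> with \<open>J u = v\<close>;
  equivalently the element of least energy in the fibre over \<open>v\<close>.\<close>

definition trace_lift ::
    "('a::chilbert \<rightharpoonup> real) \<Rightarrow> ('a \<rightharpoonup> 'b::chilbert) \<Rightarrow> real \<Rightarrow> 'b \<Rightarrow> 'a \<Rightarrow> bool" where
  "trace_lift E J l v u \<longleftrightarrow> J u = Some v \<and>
     u \<in> form_orthogonal_complement (shifted_form E l) (op_kernel J)"

locale form_trace =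
  fixes E :: "'h::chilbert \<rightharpoonup> real" and J :: "'h \<rightharpoonup> 'k::chilbert"
  assumes E: "closed_form E" and J: "linear_operator J" and dom_J: "dom J \<subseteq> dom E"
    and J_closed: "closed_from_form E J"
begin

lemma E_pos: "positive_form E"
  by (rule closed_form_positive[OF E])

lemma J_dom_E: "J u = Some v \<Longrightarrow> u \<in> dom E"
  using dom_J by blast

lemma kernel_dom_E: "k \<in> op_kernel J \<Longrightarrow> k \<in> dom E"
  using J_dom_E by (simp add: op_kernel_def)

lemma J_limit:
  assumes X: "\<And>n. J (X n) = Some (y n)" and u: "u \<in> dom E"
    and lim: "(\<lambda>n. the (shifted_form E 1 (X n - u))) \<longlonglongrightarrow> 0" and y: "y \<longlonglongrightarrow> w"
  shows "J u = Some w"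
proof -
  have "(\<lambda>n. the (J (X n))) \<longlonglongrightarrow> w" using y by (simp add: X)
  then show ?thesis
    using J_closed u lim domI[of J, OF X] unfolding closed_from_form_def by blast
qed

context
  fixes l :: real
  assumes l: "l > 0"
begin

abbreviation "El \<equiv> shifted_form E l"

lemma El_pos: "positive_form El"
  by (rule positive_form_shifted[OF E_pos less_imp_le[OF l]])

lemma El_value: "u \<in> dom E \<Longrightarrow> the (El u) = the (E u) + l * (norm u)\<^sup>2"
  by (simp add: shifted_form_value penalized_def del: domIff)

lemma El_ge: "u \<in> dom E \<Longrightarrow> the (E u) \<le> the (El u)" "u \<in> dom E \<Longrightarrow> l * (norm u)\<^sup>2 \<le> the (El u)"
  using l positive_form_nonneg[OF E_pos, of u] by (simp_all add: El_value del: domIff)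

lemma El_eq_zero: "u \<in> dom E \<Longrightarrow> the (El u) \<le> 0 \<Longrightarrow> u = 0"
  using El_ge(2)[of u] l by (smt (verit) mult_pos_pos norm_eq_zero zero_less_power2)

text \<open>A minimizer of \<open>E\<^sub>\<lambda>\<close> over the fibre \<open>{w. J w = v}\<close> exists because closedness of \<open>J\<close> makes the
  fibre closed; the Euler equation says that it is orthogonal to the kernel.\<close>

lemma trace_lift_exists:
  assumes v: "v \<in> ran J"
  obtains u where "trace_lift E J l v u"
proof -
  define S where "S = {w. J w = Some v}"
  have SE: "S \<subseteq> dom E" using J_dom_E by (auto simp: S_def)
  have mid: "(1/2) *\<^sub>R (x + y) \<in> S" if "x \<in> S" "y \<in> S" for x y
  proof -
    have "J ((1/2) *\<^sub>R (x + y)) = Some ((1/2) *\<^sub>R (v + v))"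
      unfolding scaleR_scaleC using that
      by (intro linear_operator_scaleC[OF J] linear_operator_add[OF J]) (simp_all add: S_def)
    then show ?thesis by (simp add: S_def flip: scaleR_2)
  qed
  obtain w where w: "J w = Some v" using v unfolding ran_def by blast
  obtain X u where X: "\<And>n. X n \<in> S" "X \<longlonglongrightarrow> u" and u: "u \<in> dom E"
    and Xu: "(\<lambda>n. the (E (X n - u))) \<longlonglongrightarrow> 0"
    and min: "\<And>c. (\<And>n::nat. \<exists>w\<in>S. penalized E l 0 w \<le> c) \<Longrightarrow> penalized E l 0 u \<le> c"
  proof (rule nested_minimization[OF E l, of "\<lambda>_. S" 0 "penalized E l 0 w"])
    show "\<exists>x\<in>S. penalized E l 0 x \<le> penalized E l 0 w" using w by (auto simp: S_def)
  qed (use SE mid in \<open>auto simp: decseq_def\<close>)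
  have XJ: "J (X n) = Some v" for n using X(1) by (simp add: S_def)
  have d: "X n - u \<in> dom E" for n using E_pos X(1) SE u by (intro form_closed) auto
  have "(\<lambda>n. the (E (X n - u)) + 1 * (norm (X n - u))\<^sup>2) \<longlonglongrightarrow> 0 + 1 * (norm (u - u))\<^sup>2"
    by (intro tendsto_intros Xu X(2))
  then have "(\<lambda>n. the (shifted_form E 1 (X n - u))) \<longlonglongrightarrow> 0"
    by (simp add: shifted_form_value[OF d] penalized_def)
  then have Ju: "J u = Some v"
    by (rule J_limit[OF XJ u _ tendsto_const])
  have "sesq El u k = 0" if k: "k \<in> op_kernel J" for k
  proof -
    have "sesq E u k + l * cinner (u - 0) k = 0"
    proof (rule euler_equation[OF E_pos u op_kernel_subspace(1)[OF J] _ _ k])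
      show "op_kernel J \<subseteq> dom E" using kernel_dom_E by blast
      show "penalized E l 0 u \<le> penalized E l 0 (u + h)" if "h \<in> op_kernel J" for h
      proof (rule min)
        have "u + h \<in> S"
          using linear_operator_add[OF J Ju, of h 0] that by (simp add: S_def op_kernel_def)
        then show "\<exists>w\<in>S. penalized E l 0 w \<le> penalized E l 0 (u + h)" by blast
      qed
    qed
    then show ?thesis
      using sesq_shifted[OF E_pos less_imp_le[OF l] u kernel_dom_E[OF k]] by simp
  qed
  then show thesis
    using that[of u] u Ju unfolding trace_lift_def form_orthogonal_complement_def
    by (simp del: domIff)
qed

lemma trace_liftD:
  assumes "trace_lift E J l v u"
  shows "J u = Some v" "u \<in> dom E" "k \<in> op_kernel J \<Longrightarrow> sesq El u k = 0"
  using assms unfolding trace_lift_def form_orthogonal_complement_def by auto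

lemma trace_lift_add:
  assumes u: "trace_lift E J l v u" and u': "trace_lift E J l v' u'"
  shows "trace_lift E J l (v + v') (u + u')"
proof -
  note d = trace_liftD[OF u] trace_liftD[OF u']
  have "sesq El (u + u') k = 0" if "k \<in> op_kernel J" for k
    using sesq_add_left[OF El_pos, of u u' k] d that kernel_dom_E[OF that] by simp
  then show ?thesis
    using linear_operator_add[OF J d(1,4)] d(2,5) form_closed(1)[OF E_pos]
    unfolding trace_lift_def form_orthogonal_complement_def by simp
qed

lemma trace_lift_scaleC:
  assumes u: "trace_lift E J l v u"
  shows "trace_lift E J l (a *\<^sub>C v) (a *\<^sub>C u)"
proof -
  note d = trace_liftD[OF u]
  have "sesq El (a *\<^sub>C u) k = 0" if "k \<in> op_kernel J" for k
    using sesq_scaleC_left[OF El_pos, of u k a] d that kernel_dom_E[OF that] by simp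
  then show ?thesis
    using linear_operator_scaleC[OF J d(1)] d(2) form_closed(3)[OF E_pos]
    unfolding trace_lift_def form_orthogonal_complement_def by simp
qed

lemma trace_lift_diff:
  assumes "trace_lift E J l v u" "trace_lift E J l v' u'"
  shows "trace_lift E J l (v - v') (u - u')"
  using trace_lift_add[OF assms(1) trace_lift_scaleC[OF assms(2), of "- 1"]]
  by (simp add: scaleC_minus_one)

lemma trace_projection_eq_lift:
  assumes u: "trace_lift E J l v u" and w: "J w = Some v"
  shows "trace_projection E J l w = u"
  unfolding trace_projection_def form_projection_def
proof (rule the_equality)
  let ?M = "form_orthogonal_complement El (op_kernel J)"
  have wE: "w \<in> dom E" and uE: "u \<in> dom E" using J_dom_E[OF w] trace_liftD(2)[OF u] .
  have ker: "w - u \<in> op_kernel J"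
    using linear_operator_diff[OF J w trace_liftD(1)[OF u]] by (simp add: op_kernel_def)
  have orth: "sesq El (w - u) z = 0" if "z \<in> ?M" for z
    using that sesq_commute[OF El_pos, of z "w - u"] kernel_dom_E[OF ker] ker
    unfolding form_orthogonal_complement_def by simp
  have uM: "u \<in> ?M" using u unfolding trace_lift_def by blast
  with orth show "u \<in> ?M \<and> (\<forall>z\<in>?M. sesq El (w - u) z = 0)" by blast
  fix w' assume w': "w' \<in> ?M \<and> (\<forall>z\<in>?M. sesq El (w - w') z = 0)"
  then have w'E: "w' \<in> dom E" by (simp add: form_orthogonal_complement_def)
  have dE: "w' - u \<in> dom E" "w - u \<in> dom E" "w - w' \<in> dom E"
    using E_pos wE uE w'E by (simp_all add: form_closed)
  have "w' - u \<in> ?M"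
  proof -
    have "sesq El (w' - u) k = 0" if k: "k \<in> op_kernel J" for k
      using sesq_diff_left[OF El_pos, of w' u k] w' uM k w'E uE kernel_dom_E[OF k]
      by (simp add: form_orthogonal_complement_def)
    then show ?thesis using dE(1) by (simp add: form_orthogonal_complement_def)
  qed
  moreover have "sesq El ((w - u) - (w - w')) (w' - u)
      = sesq El (w - u) (w' - u) - sesq El (w - w') (w' - u)"
    by (rule sesq_diff_left[OF El_pos]) (use dE in simp_all)
  ultimately have "sesq El (w' - u) (w' - u) = 0" using orth w' by simp
  then have "the (El (w' - u)) = 0" using positive_form_sesq(2)[OF El_pos, of "w' - u"] dE(1) by simp
  then show "w' = u" using El_eq_zero[OF dE(1)] by simp
qed

lemma trace_form_lift:
  assumes u: "trace_lift E J l v u"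
  shows "trace_form E J l v = Some (the (El u))"
proof -
  have "v \<in> ran J" using trace_liftD(1)[OF u] by (rule ranI)
  moreover have "(THE r. \<forall>w. J w = Some v \<longrightarrow> r = the (El (trace_projection E J l w))) = the (El u)"
    using trace_projection_eq_lift[OF u] trace_liftD(1)[OF u] by (intro the_equality) auto
  ultimately show ?thesis by (simp add: trace_form_def)
qed

text \<open>Pythagoras: \<open>w\<close> differs from the lift of \<open>v\<close> by an element of the kernel.\<close>

lemma trace_form_le:
  assumes w: "J w = Some v"
  shows "the (trace_form E J l v) \<le> the (El w)"
proof -
  obtain u where u: "trace_lift E J l v u" using trace_lift_exists ranI[of J w v] w by blast
  note d = trace_liftD[OF u]
  have k: "w - u \<in> op_kernel J"
    using linear_operator_diff[OF J w d(1)] by (simp add: op_kernel_def)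
  have "the (El (u + (w - u))) = the (El u) + the (El (w - u)) + 2 * Re (sesq El u (w - u))"
    by (rule form_add[OF El_pos]) (use d(2) kernel_dom_E[OF k] in simp_all)
  then show ?thesis
    using d(3)[OF k] positive_form_nonneg[OF El_pos, of "w - u"] kernel_dom_E[OF k]
    by (simp add: trace_form_lift[OF u])
qed

end

lemma dom_trace_form [simp]: "dom (trace_form E J l) = ran J"
  by (auto simp: trace_form_def split: if_splits)

text \<open>Lifting \<open>v\<close> to its energy-minimal preimage is linear and isometric from the trace form to
  \<open>E\<^sub>\<lambda>\<close>, so a Cauchy sequence lifts to a Cauchy sequence, whose limit is mapped by the closed
  operator \<open>J\<close> to the limit of the original one.\<close>

lemma closed_form_trace_form:
  assumes l: "l > 0"
  shows "closed_form (trace_form E J l)"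
proof -
  let ?El = "shifted_form E l"
  note El = El_pos[OF l]
  define L where "L v = (SOME u. trace_lift E J l v u)" for v
  have L: "trace_lift E J l v (L v)" if v: "v \<in> ran J" for v
  proof -
    obtain u where "trace_lift E J l v u" using trace_lift_exists[OF l v] .
    then show ?thesis unfolding L_def by (rule someI)
  qed
  have unique: "u = u'" if "trace_lift E J l v u" "trace_lift E J l v u'" for v u u'
    using trace_projection_eq_lift[OF l that(1) trace_liftD(1)[OF l that(1)]]
      trace_projection_eq_lift[OF l that(2) trace_liftD(1)[OF l that(1)]] by simp
  have ran: "csubspace (ran J)" by (rule csubspace_ran[OF J])
  have L_add: "L (x + y) = L x + L y" if "x \<in> ran J" "y \<in> ran J" for x y
    by (rule unique[OF L trace_lift_add[OF l L L]]) (use that ran in \<open>simp_all add: csubspace_add\<close>)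
  have L_scale: "L (a *\<^sub>C x) = a *\<^sub>C L x" if "x \<in> ran J" for a x
    by (rule unique[OF L trace_lift_scaleC[OF l L]]) (use that ran in \<open>simp_all add: csubspace_scaleC\<close>)
  have L_diff: "L (x - y) = L x - L y" if "x \<in> ran J" "y \<in> ran J" for x y
    by (rule unique[OF L trace_lift_diff[OF l L L]]) (use that ran in \<open>simp_all add: csubspace_diff\<close>)
  have LE: "L x \<in> dom ?El" if "x \<in> ran J" for x
    using trace_liftD(2)[OF l L[OF that]] by simp
  have energy: "the (trace_form E J l x) = the (?El (L x))" if "x \<in> ran J" for x
    by (simp add: trace_form_lift[OF l L[OF that]])
  define s where "s x y = sesq ?El (L x) (L y)" for x y
  have "sesquilinear_on (ran J) s"
    unfolding sesquilinear_on_def s_def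
    by (simp add: L_add L_scale LE sesq_add_left[OF El] sesq_add_right[OF El]
        sesq_scaleC_left[OF El] sesq_scaleC_right[OF El] del: domIff dom_shifted_form)
  moreover have "s x x = complex_of_real (the (trace_form E J l x))" if "x \<in> ran J" for x
    by (simp only: s_def energy[OF that] positive_form_sesq(2)[OF El LE[OF that]])
  moreover have "0 \<le> the (trace_form E J l x)" if "x \<in> ran J" for x
    by (simp only: energy[OF that] positive_form_nonneg[OF El LE[OF that]])
  ultimately have pos: "positive_form (trace_form E J l)"
    unfolding positive_form_def dom_trace_form using ran by blast
  show ?thesis
    unfolding closed_form_def dom_trace_form
  proof (intro conjI allI impI pos)
    fix X v
    assume *: "(\<forall>n. X n \<in> ran J) \<and> X \<longlonglongrightarrow> v \<and>
      (\<forall>e>0. \<exists>N. \<forall>m\<ge>N. \<forall>n\<ge>N. the (trace_form E J l (X m - X n)) < e)"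
    then have X: "\<And>n. X n \<in> ran J" "X \<longlonglongrightarrow> v" by auto
    define w where "w n = L (X n)" for n
    have wE: "w n \<in> dom E" for n using LE[OF X(1)] by (simp add: w_def)
    have dE: "w m - w n \<in> dom E" for m n using E_pos wE by (simp add: form_closed)
    have energy_diff: "the (trace_form E J l (X m - X n)) = the (?El (w m - w n))" for m n
      using energy[OF csubspace_diff[OF ran X(1) X(1)]] L_diff[OF X(1) X(1)] by (simp add: w_def)
    have cauchy: "\<exists>N. \<forall>m\<ge>N. \<forall>n\<ge>N. the (?El (w m - w n)) < e" if "e > 0" for e
      using * that by (simp add: energy_diff)
    have "Cauchy w"
    proof (rule CauchyI)
      fix e :: real assume e: "e > 0"
      then obtain N where N: "\<And>m n. m \<ge> N \<Longrightarrow> n \<ge> N \<Longrightarrow> the (?El (w m - w n)) < l * e\<^sup>2"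
        using cauchy[of "l * e\<^sup>2"] l by auto
      have "norm (w m - w n) < e" if "m \<ge> N" "n \<ge> N" for m n
      proof -
        have "l * (norm (w m - w n))\<^sup>2 < l * e\<^sup>2"
          using El_ge(2)[OF l dE] N[OF that] by (rule le_less_trans)
        then show ?thesis using l e by (simp add: power_less_imp_less_base)
      qed
      then show "\<exists>N. \<forall>m\<ge>N. \<forall>n\<ge>N. norm (w m - w n) < e" by blast
    qed
    then obtain u where u: "w \<longlonglongrightarrow> u" using convergent_eq_Cauchy by blast
    have "\<exists>N. \<forall>m\<ge>N. \<forall>n\<ge>N. the (E (w m - w n)) < e" if e: "e > 0" for e
    proof -
      obtain N where "\<And>m n. m \<ge> N \<Longrightarrow> n \<ge> N \<Longrightarrow> the (?El (w m - w n)) < e"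
        using cauchy[OF e] by blast
      then show ?thesis using El_ge(1)[OF l dE] le_less_trans by blast
    qed
    then have uE: "u \<in> dom E" and lim: "(\<lambda>n. the (E (w n - u))) \<longlonglongrightarrow> 0"
      using E wE u unfolding closed_form_def by blast+
    have wuE: "w n - u \<in> dom E" for n using E_pos wE uE by (simp add: form_closed)
    have El_lim: "(\<lambda>n. the (shifted_form E a (w n - u))) \<longlonglongrightarrow> 0" for a
    proof -
      have "(\<lambda>n. the (E (w n - u)) + a * (norm (w n - u))\<^sup>2) \<longlonglongrightarrow> 0 + a * (norm (u - u))\<^sup>2"
        by (intro tendsto_intros lim u)
      then show ?thesis by (simp add: shifted_form_value[OF wuE] penalized_def)
    qed
    have Jw: "J (w n) = Some (X n)" for n
      using trace_liftD(1)[OF l L[OF X(1)]] by (simp add: w_def)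
    have Ju: "J u = Some v"
      by (rule J_limit[OF Jw uE El_lim X(2)])
    then show "v \<in> ran J" by (rule ranI)
    have JX: "J (w n - u) = Some (X n - v)" for n by (rule linear_operator_diff[OF J Jw Ju])
    show "(\<lambda>n. the (trace_form E J l (X n - v))) \<longlonglongrightarrow> 0"
    proof (rule tendsto_sandwich[OF always_eventually always_eventually tendsto_const El_lim[of l]])
      show "\<forall>n. 0 \<le> the (trace_form E J l (X n - v))"
        using positive_form_nonneg[OF pos] csubspace_diff[OF ran X(1) ranI[of J, OF Ju]] by simp
      show "\<forall>n. the (trace_form E J l (X n - v)) \<le> the (?El (w n - u))"
        using trace_form_le[OF l JX] by blast
    qed
  qed
qed

text \<open>The lift for \<open>m\<close> is a competitor for \<open>l\<close>.\<close>

lemma trace_form_mono: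
  assumes l: "0 < l" and lm: "l \<le> m" and v: "v \<in> ran J"
  shows "the (trace_form E J l v) \<le> the (trace_form E J m v)"
proof -
  have m: "0 < m" using l lm by simp
  obtain u where u: "trace_lift E J m v u" using trace_lift_exists[OF m v] .
  note d = trace_liftD(1,2)[OF m u]
  have "the (trace_form E J l v) \<le> the (shifted_form E l u)" by (rule trace_form_le[OF l d(1)])
  also have "\<dots> \<le> the (shifted_form E m u)"
    using lm by (simp add: El_value[OF l d(2)] El_value[OF m d(2)] mult_right_mono)
  finally show ?thesis by (simp add: trace_form_lift[OF m u])
qed

lemma trace_form_zero_limit:
  assumes v: "v \<in> ran J"
  shows "((\<lambda>l. the (trace_form E J l v)) \<longlongrightarrow> the (trace_form_zero E J v)) (at_right 0)"
    and "l > 0 \<Longrightarrow> the (trace_form_zero E J v) \<le> the (trace_form E J l v)"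
proof -
  define g where "g l = the (trace_form E J l v)" for l
  define c where "c = Inf (g ` {0<..})"
  have "0 \<le> g l" if "l > 0" for l
    using positive_form_nonneg[OF closed_form_positive[OF closed_form_trace_form[OF that]]] v
    by (simp add: g_def)
  then have bdd: "bdd_below (g ` {0<..})" by (intro bdd_belowI[of _ 0]) auto
  have c_le: "c \<le> g l" if "l > 0" for l
    unfolding c_def using bdd that by (intro cInf_lower) auto
  have lim: "(g \<longlongrightarrow> c) (at_right 0)"
  proof (rule order_tendstoI)
    show "\<forall>\<^sub>F l in at_right 0. a < g l" if "a < c" for a
      using c_le that by (intro eventually_at_rightI[of 0 1]) (auto intro: less_le_trans)
    show "\<forall>\<^sub>F l in at_right 0. g l < a" if "c < a" for a
    proof -
      have "\<exists>x\<in>g ` {0<..}. x < a" by (rule cInf_lessD) (use that in \<open>auto simp: c_def\<close>)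
      then obtain m where m: "m > 0" "g m < a" by auto
      have "g l < a" if "l \<in> {0<..<m}" for l
        using trace_form_mono[of l m v] v m(2) that by (simp add: g_def)
      then show ?thesis using m(1) by (intro eventually_at_rightI[of 0 m]) auto
    qed
  qed
  have "the (trace_form_zero E J v) = c"
    using tendsto_Lim[OF _ lim] v by (simp add: trace_form_zero_def g_def[abs_def])
  then show "((\<lambda>l. the (trace_form E J l v)) \<longlongrightarrow> the (trace_form_zero E J v)) (at_right 0)"
    and "l > 0 \<Longrightarrow> the (trace_form_zero E J v) \<le> the (trace_form E J l v)"
    using lim c_le unfolding g_def by auto
qed

lemma dom_trace_form_zero [simp]: "dom (trace_form_zero E J) = ran J"
  by (auto simp: trace_form_zero_def split: if_splits)

text \<open>A pointwise limit of positive forms, along the sequence \<open>\<lambda> = 1 / (n + 1)\<close>.\<close>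

lemma positive_form_trace_form_zero: "positive_form (trace_form_zero E J)"
proof (rule positive_form_limit[where Q = "\<lambda>n. trace_form E J (inverse (Suc n))"
      and approx = "\<lambda>w u. u \<in> ran J \<and> w = (\<lambda>_. u)"])
  show "positive_form (trace_form E J (inverse (real (Suc n))))" for n
    by (rule closed_form_positive[OF closed_form_trace_form]) simp
  show "csubspace (dom (trace_form_zero E J))" using csubspace_ran[OF J] by simp
  show "(\<lambda>n. the (trace_form E J (inverse (real (Suc n))) (w n))) \<longlonglongrightarrow> the (trace_form_zero E J u)"
    if "u \<in> ran J \<and> w = (\<lambda>_. u)" for w u
  proof -
    have "filterlim (\<lambda>n. inverse (real (Suc n))) (at_right 0) sequentially"
      by (rule tendsto_imp_filterlim_at_right[OF LIMSEQ_inverse_real_of_nat]) simp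
    from filterlim_compose[OF trace_form_zero_limit(1) this] that show ?thesis by simp
  qed
qed (auto simp: csubspace_add[OF csubspace_ran[OF J]] csubspace_scaleC[OF csubspace_ran[OF J]])

end

theorem theorem2p4:
  fixes E :: "'h::chilbert \<rightharpoonup> real" and J :: "'h \<rightharpoonup> 'k::chilbert"
  assumes "closed_form E"
    and "linear_operator J"
    and "dom J \<subseteq> dom E"
    and "closure (ran J) = UNIV"
    and "closed_from_form E J"
  shows "(\<forall>v\<in>ran J. ((\<lambda>l. the (trace_form E J l v)) \<longlongrightarrow> the (trace_form_zero E J v)) (at_right 0)) \<and>
    (\<exists>H. positive_self_adjoint H \<and>
       (\<forall>f. ((\<lambda>l. inv_plus_one (form_operator (trace_form E J l)) f) \<longlongrightarrow> inv_plus_one H f)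
              (at_right 0)) \<and>
       (\<exists>R C. is_regular_part (trace_form_zero E J) R \<and> is_form_closure R C \<and>
              H = form_operator C) \<and>
       (closable_form (trace_form_zero E J) \<longrightarrow>
         (\<exists>C. is_form_closure (trace_form_zero E J) C \<and> H = form_operator C)))"
proof -
  interpret form_trace E J using assms by unfold_locales
  let ?q = "trace_form_zero E J"
  let ?C = "relaxation ?q"
  let ?H = "form_operator ?C"
  note q = positive_form_trace_form_zero
  have D: "densely_defined ?q" using assms(4) by (simp add: densely_defined_def)
  have Dl: "densely_defined (trace_form E J l)" for l using assms(4) by (simp add: densely_defined_def)
  note C = closed_form_relaxation[OF q]
  have DC: "densely_defined ?C"
    using closure_mono[OF dom_subset_relaxation[of ?q]] D unfolding densely_defined_def by blast
  have conv: "((\<lambda>l. inv_plus_one (form_operator (trace_form E J l)) f) \<longlongrightarrow> inv_plus_one ?H f)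
      (at_right 0)" for f
  proof (rule Lim_transform_eventually)
    show "((\<lambda>l. minimizer (trace_form E J l) 1 f) \<longlongrightarrow> inv_plus_one ?H f) (at_right 0)"
      unfolding inv_plus_one_form_operator[OF C DC]
    proof (rule minimizer_tendsto_relaxation[OF q])
      show "\<forall>\<^sub>F l in at_right 0. closed_form (trace_form E J l) \<and> dom (trace_form E J l) = dom ?q \<and>
          (\<forall>u\<in>dom ?q. the (?q u) \<le> the (trace_form E J l u))"
        by (rule eventually_at_rightI[of 0 1])
          (simp_all add: closed_form_trace_form trace_form_zero_limit(2) del: domIff)
      show "((\<lambda>l. the (trace_form E J l u)) \<longlongrightarrow> the (?q u)) (at_right 0)" if "u \<in> dom ?q" for u
        using trace_form_zero_limit(1) that by simp
    qed
    show "\<forall>\<^sub>F l in at_right 0.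
        minimizer (trace_form E J l) 1 f = inv_plus_one (form_operator (trace_form E J l)) f"
      by (rule eventually_at_rightI[of 0 1])
        (simp_all add: inv_plus_one_form_operator[OF closed_form_trace_form Dl])
  qed
  have closable: "is_form_closure ?q ?C" if "closable_form ?q"
    using relaxation_regular_part(2)[OF q D] unfolding closable_form_eq_regular_part[OF that D] .
  show ?thesis
    using trace_form_zero_limit(1) positive_self_adjoint_form_operator[OF C DC] conv
      relaxation_regular_part[OF q D] closable by blast
qed

end
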